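(* Let $H$ be the operator $H_\omega$ with $\omega(n)=0$ for all $n\in I$ (the selfadjoint operator without point interactions), and let $E\in\mathbb{R}$, $A(E):=\{\omega\in\Omega: E\in\sigma_p(H_\omega)\}$. (a) If $E\notin\sigma_p(H)$, then $\mathbb{P}(B)=0$ for every measurable subset $B$ of $A(E)$. (b) If $E\in\sigma_p(H)$ with $Hu=Eu$, where $u\in D(H)$, $u\not\equiv 0$, then $A(E)=\Omega$ if and only if $u(x_n)=0$ for all $n\in I$.
   Context: Probability space: let $I\subseteq\mathbb{Z}$ and let $\{p_n\}_{n\in I}$ be probability measures on $\mathbb{R}$ that are continuous, i.e. $p_n(\{r\})=0$ for all $r\in\mathbb{R}$. $\Omega$ denotes the completion of the product probability space $(\mathbb{R}^I,\mathcal{F},\mathbb{P})$, where $\mathbb{P}=\times_{n\in I}p_n$ and $\mathcal{F}$ is the product $\sigma$-algebra generated by cylinder sets; elements are sequences $\omega=\{\omega(n)\}_{n\in I}$, and "measurable" refers to the completed $\sigma$-algebra. Operators ($\delta$-interactions): let $-\infty\le a<b\le\infty$, let $V\in L^1_{loc}(a,b)$ be real valued, and let $M=\{x_n\}_{n\in I}\subset(a,b)$ be a discrete set of distinct points which accumulate at most at $a$ or $b$. Let $\tau f=-f''+Vf$. For $\omega\in\Omega$, the formal expression $\tau_\omega=-\frac{d^2}{dx^2}+V(x)+\sum_{n\in I}\omega(n)\delta(x-x_n)$ has maximal operator $T_\omega f=\tau f$ with domain $D(T_\omega)$ consisting of all $f\in L^2(a,b)$ such that $f,f'$ are (locally) absolutely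 continuous in $(a,b)\setminus M$, $-f''+Vf\in L^2(a,b)$, and $f(x_n+)=f(x_n-)$, $f'(x_n+)-f'(x_n-)=\omega(n)f(x_n)$ for all $n\in I$. A solution of $(\tau_\omega-z)f=0$ ($z\in\mathbb{C}$) is a function $f$ with $f,f'$ (locally) absolutely continuous in $(a,b)\setminus M$, $-f''+Vf-zf=0$, satisfying the same conditions at all $x_n$. $\tau_\omega$ is regular at $a$ if $a$ is finite, $V\in L^1_{loc}[a,b)$ and $a$ is not an accumulation point of $M$; it is in the limit point case (lpc) at $a$ if for every $z\in\mathbb{C}$ there is at least one solution of $(\tau_\omega-z)f=0$ which is not square integrable near $a$; similarly at $b$. Standing assumption: at each of the endpoints $a$, $b$, $\tau_\omega$ is either regular or in the limit point case (for the operators $H_\omega$, $\omega\in\Omega$). For fixed $\theta,\gamma\in[0,\pi)$, $H_\omega$ is the selfadjoint restriction of $T_\omega$ to those $f\in D(T_\omega)$ satisfying $f(a)\cos\theta+f'(a)\sin\theta=0$ if $\tau_\omega$ is regular at $a$, and $f(b)\cos\gamma+f'(b)\sin\gamma=0$ if $\tau_\omega$ is regular at $b$ (no condition at an lpc endpoint). $\sigma_p(L)$ denotes the set of eigenvalues of $L$. *)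

theory Defs
  imports "HOL-Probability.Probability"
begin

text \<open>
  The probability space. Each \<^term>\<open>p n\<close> is a Borel probability measure on the line; configurations
  are elements of \<^term>\<open>PiE I (\<lambda>_. UNIV)\<close>, i.e. functions that are \<^term>\<open>undefined\<close> off \<^term>\<open>I\<close>.
\<close>

definition config_space :: "int set \<Rightarrow> (int \<Rightarrow> real measure) \<Rightarrow> (int \<Rightarrow> real) measure" where
  "config_space I p = completion (PiM I p)"


definition abs_cont_on :: "real set \<Rightarrow> (real \<Rightarrow> complex) \<Rightarrow> bool" where
  "abs_cont_on S f \<longleftrightarrow>
     (\<forall>\<epsilon>>0. \<exists>\<delta>>0. \<forall>\<D> T. \<D> division_of T \<and> T \<subseteq> S \<and> (\<Sum>K\<in>\<D>. Sup K - Inf K) < \<delta>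
        \<longrightarrow> (\<Sum>K\<in>\<D>. norm (f (Sup K) - f (Inf K))) < \<epsilon>)"

definition loc_abs_cont_on :: "real set \<Rightarrow> (real \<Rightarrow> complex) \<Rightarrow> bool" where
  "loc_abs_cont_on S f \<longleftrightarrow> (\<forall>c d. {c..d} \<subseteq> S \<longrightarrow> abs_cont_on {c..d} f)"

definition L1_loc :: "real set \<Rightarrow> (real \<Rightarrow> real) \<Rightarrow> bool" where
  "L1_loc S V \<longleftrightarrow> (\<forall>K. compact K \<and> K \<subseteq> S \<longrightarrow> V absolutely_integrable_on K)"

definition L2 :: "real set \<Rightarrow> (real \<Rightarrow> complex) \<Rightarrow> bool" where
  "L2 S f \<longleftrightarrow> f \<in> borel_measurable (lebesgue_on S) \<and>
     integrable (lebesgue_on S) (\<lambda>t. (norm (f t))\<^sup>2)"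


text \<open>
  Functions on \<open>(a,b)\<close> are represented by total functions on the line whose values outside \<open>(a,b)\<close>
  are never used. An operator is a pair of a domain and an action, and equality in \<open>L\<^sup>2(a,b)\<close> is
  equality almost everywhere on \<open>(a,b)\<close>.
\<close>

type_synonym l2_operator = "(real \<Rightarrow> complex) set \<times> ((real \<Rightarrow> complex) \<Rightarrow> real \<Rightarrow> complex)"

definition ae_eq_on :: "real set \<Rightarrow> (real \<Rightarrow> complex) \<Rightarrow> (real \<Rightarrow> complex) \<Rightarrow> bool" where
  "ae_eq_on S f g \<longleftrightarrow> (AE t in lebesgue_on S. f t = g t)"

definition is_eigenfunction ::
  "real set \<Rightarrow> l2_operator \<Rightarrow> complex \<Rightarrow> (real \<Rightarrow> complex) \<Rightarrow> bool" where
  "is_eigenfunction S L z u \<longleftrightarrow>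
     u \<in> fst L \<and> \<not> ae_eq_on S u (\<lambda>_. 0) \<and> ae_eq_on S (snd L u) (\<lambda>t. z * u t)"

definition sigma_p :: "real set \<Rightarrow> l2_operator \<Rightarrow> complex set" where
  "sigma_p S L = {z. \<exists>u. is_eigenfunction S L z u}"


abbreviation D1 :: "(real \<Rightarrow> complex) \<Rightarrow> real \<Rightarrow> complex" where
  "D1 f \<equiv> (\<lambda>t. vector_derivative f (at t))"

text \<open>
  The second derivative of an admissible function exists only almost everywhere; on the
  exceptional null set (which includes the points \<open>x n\<close>) the value of \<open>tau V f\<close> is irrelevant.
\<close>

definition tau :: "(real \<Rightarrow> real) \<Rightarrow> (real \<Rightarrow> complex) \<Rightarrow> real \<Rightarrow> complex" where
  "tau V f t = - D1 (D1 f) t + of_real (V t) * f t"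

text \<open>
  Requiring \<^term>\<open>isCont f (x n)\<close> says \<open>f(x\<^sub>n+) = f(x\<^sub>n-)\<close> and moreover picks the representative with
  \<open>f(x\<^sub>n)\<close> equal to this common value; \<open>r\<close> and \<open>l\<close> are \<open>f'(x\<^sub>n+)\<close> and \<open>f'(x\<^sub>n-)\<close>.
\<close>

definition delta_admissible ::
  "ereal \<Rightarrow> ereal \<Rightarrow> int set \<Rightarrow> (int \<Rightarrow> real) \<Rightarrow> (int \<Rightarrow> real) \<Rightarrow> (real \<Rightarrow> complex) \<Rightarrow> bool" where
  "delta_admissible a b I x \<omega> f \<longleftrightarrow>
     (\<forall>t \<in> einterval a b - x ` I. f differentiable at t) \<and>
     loc_abs_cont_on (einterval a b - x ` I) f \<and>
     loc_abs_cont_on (einterval a b - x ` I) (D1 f) \<and>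
     (\<forall>n\<in>I. isCont f (x n) \<and>
        (\<exists>l r. (D1 f \<longlongrightarrow> l) (at_left (x n)) \<and> (D1 f \<longlongrightarrow> r) (at_right (x n)) \<and>
               r - l = of_real (\<omega> n) * f (x n)))"

definition is_solution ::
  "ereal \<Rightarrow> ereal \<Rightarrow> (real \<Rightarrow> real) \<Rightarrow> int set \<Rightarrow> (int \<Rightarrow> real) \<Rightarrow> (int \<Rightarrow> real)
     \<Rightarrow> complex \<Rightarrow> (real \<Rightarrow> complex) \<Rightarrow> bool" where
  "is_solution a b V I x \<omega> z f \<longleftrightarrow>
     delta_admissible a b I x \<omega> f \<and> ae_eq_on (einterval a b) (\<lambda>t. tau V f t - z * f t) (\<lambda>_. 0)"

definition T_op ::
  "ereal \<Rightarrow> ereal \<Rightarrow> (real \<Rightarrow> real) \<Rightarrow> int set \<Rightarrow> (int \<Rightarrow> real) \<Rightarrow> (int \<Rightarrow> real) \<Rightarrow> l2_operator" where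
  "T_op a b V I x \<omega> =
     ({f. L2 (einterval a b) f \<and> delta_admissible a b I x \<omega> f \<and> L2 (einterval a b) (tau V f)},
      tau V)"


definition regular_left ::
  "ereal \<Rightarrow> ereal \<Rightarrow> (real \<Rightarrow> real) \<Rightarrow> int set \<Rightarrow> (int \<Rightarrow> real) \<Rightarrow> bool" where
  "regular_left a b V I x \<longleftrightarrow>
     \<bar>a\<bar> \<noteq> \<infinity> \<and> L1_loc {t. a \<le> ereal t \<and> ereal t < b} V \<and> \<not> real_of_ereal a islimpt x ` I"

definition regular_right ::
  "ereal \<Rightarrow> ereal \<Rightarrow> (real \<Rightarrow> real) \<Rightarrow> int set \<Rightarrow> (int \<Rightarrow> real) \<Rightarrow> bool" where
  "regular_right a b V I x \<longleftrightarrow>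
     \<bar>b\<bar> \<noteq> \<infinity> \<and> L1_loc {t. a < ereal t \<and> ereal t \<le> b} V \<and> \<not> real_of_ereal b islimpt x ` I"

definition lpc_left ::
  "ereal \<Rightarrow> ereal \<Rightarrow> (real \<Rightarrow> real) \<Rightarrow> int set \<Rightarrow> (int \<Rightarrow> real) \<Rightarrow> (int \<Rightarrow> real) \<Rightarrow> bool" where
  "lpc_left a b V I x \<omega> \<longleftrightarrow>
     (\<forall>z. \<exists>f. is_solution a b V I x \<omega> z f \<and>
        \<not> (\<exists>c \<in> einterval a b. L2 (einterval a (ereal c)) f))"

definition lpc_right ::
  "ereal \<Rightarrow> ereal \<Rightarrow> (real \<Rightarrow> real) \<Rightarrow> int set \<Rightarrow> (int \<Rightarrow> real) \<Rightarrow> (int \<Rightarrow> real) \<Rightarrow> bool" where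
  "lpc_right a b V I x \<omega> \<longleftrightarrow>
     (\<forall>z. \<exists>f. is_solution a b V I x \<omega> z f \<and>
        \<not> (\<exists>c \<in> einterval a b. L2 (einterval (ereal c) b) f))"


text \<open>
  Values of \<open>f\<close> and \<open>f'\<close> at a regular endpoint are one-sided limits from inside \<open>(a,b)\<close>, and
  \<open>F\<close> below is the filter along which they are taken.
\<close>

definition boundary_cond :: "real filter \<Rightarrow> real \<Rightarrow> (real \<Rightarrow> complex) \<Rightarrow> bool" where
  "boundary_cond F \<theta> f \<longleftrightarrow>
     (\<exists>v v'. (f \<longlongrightarrow> v) F \<and> (D1 f \<longlongrightarrow> v') F \<and> v * of_real (cos \<theta>) + v' * of_real (sin \<theta>) = 0)"

definition H_op ::
  "ereal \<Rightarrow> ereal \<Rightarrow> (real \<Rightarrow> real) \<Rightarrow> int set \<Rightarrow> (int \<Rightarrow> real) \<Rightarrow> real \<Rightarrow> real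
     \<Rightarrow> (int \<Rightarrow> real) \<Rightarrow> l2_operator" where
  "H_op a b V I x \<theta> \<gamma> \<omega> =
     ({f \<in> fst (T_op a b V I x \<omega>).
         (regular_left a b V I x \<longrightarrow> boundary_cond (at_right (real_of_ereal a)) \<theta> f) \<and>
         (regular_right a b V I x \<longrightarrow> boundary_cond (at_left (real_of_ereal b)) \<gamma> f)},
      snd (T_op a b V I x \<omega>))"

definition A_set ::
  "ereal \<Rightarrow> ereal \<Rightarrow> (real \<Rightarrow> real) \<Rightarrow> int set \<Rightarrow> (int \<Rightarrow> real) \<Rightarrow> real \<Rightarrow> real
     \<Rightarrow> (int \<Rightarrow> real measure) \<Rightarrow> real \<Rightarrow> (int \<Rightarrow> real) set" where
  "A_set a b V I x \<theta> \<gamma> p E =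
     {\<omega> \<in> space (config_space I p).
        complex_of_real E \<in> sigma_p (einterval a b) (H_op a b V I x \<theta> \<gamma> \<omega>)}"

end

theory Submission
  imports Defs
begin

text \<open>
  Everything rests on one deterministic fact (\<open>eigenvalue_fixes_strength\<close>): if \<open>f\<close> is an eigenfunction
  of \<open>H\<^sub>\<omega>\<close> for \<open>E\<close> with \<open>f(x\<^sub>n) \<noteq> 0\<close>, then changing the single coordinate \<open>\<omega>(n)\<close> destroys the eigenvalue.
  For suppose that \<open>g\<close> is an eigenfunction for the changed configuration \<open>\<omega>'\<close> and the same \<open>E\<close>. Both
  functions solve the same equation on either side of \<open>x\<^sub>n\<close>, so their Wronskian is constant on
  either side. It vanishes there: at a regular endpoint both satisfy the same boundary condition, and
  at a limit point endpoint a nonzero Wronskian would make every solution a combination of the square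
  integrable \<open>f\<close> and \<open>g\<close>. At \<open>x\<^sub>n\<close> itself the Wronskian jumps by \<open>(\<omega>'(n) - \<omega>(n)) f(x\<^sub>n) g(x\<^sub>n)\<close>, so this
  product is zero. If \<open>g(x\<^sub>n)\<close> were zero, the vanishing of the Wronskian would give \<open>g'(x\<^sub>n-) = 0\<close> as well and
  \<open>g\<close> would be zero by unique continuation. Hence \<open>\<omega>'(n) = \<omega>(n)\<close>.
  
  An eigenfunction that vanishes at all \<open>x\<^sub>n\<close> does not feel the interactions at all and is an
  eigenfunction for every configuration; together with the previous fact, applied to the
  configuration \<open>0\<close> and one differing from it in one coordinate, this gives (b).
  
  For (a), every \<open>\<omega> \<in> A(E)\<close> has an eigenfunction that is nonzero at some \<open>x\<^sub>n\<close>, so the line through \<open>\<omega>\<close> in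
  direction \<open>n\<close> meets \<open>A(E)\<close> in \<open>\<omega>\<close> only. One would like to split \<open>B \<subseteq> A(E)\<close> according to \<open>n\<close> and apply
  Fubini to each part, but the parts need not be measurable. Instead let \<open>C\<^sub>n\<close> be the set of
  all \<open>\<omega> \<in> B\<close> whose line in direction \<open>n\<close> meets \<open>B\<close> in a \<open>p\<^sub>n\<close>-null set. These sets are measurable because \<open>B\<close> is,
  they are null by Fubini, and they cover \<open>B\<close> because \<open>p\<^sub>n\<close> has no atoms
  (\<open>emeasure_PiM_eq_0_if_null_fibres\<close>).
  
  A solution has an absolutely continuous derivative and satisfies the equation almost everywhere.
  The constancy of the Wronskian and unique continuation therefore need two facts about an absolutely
  continuous function: it is differentiable almost everywhere (\<open>AC_differentiable_ae\<close>, by Vitali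
  coverings) and it is the integral of its derivative (\<open>AC_fundamental_theorem_of_calculus\<close>, where the
  gauge integral makes the classical estimate immediate).
\<close>

section \<open>Vitali coverings by intervals\<close>

text \<open>
  The points \<open>t\<close> lie strictly inside the intervals, which makes the set of straddled points a
  countable intersection of open sets, whatever \<open>Q\<close> is.
\<close>
definition straddled :: "(real \<Rightarrow> real \<Rightarrow> bool) \<Rightarrow> real \<Rightarrow> bool" where
  "straddled Q t \<longleftrightarrow> (\<forall>e>0. \<exists>y z. y < t \<and> t < z \<and> z - y < e \<and> Q y z)"

lemma sets_straddled: "{t. straddled Q t} \<in> sets borel"
proof -
  let ?O = "\<lambda>n::nat. {t. \<exists>y z. y < t \<and> t < z \<and> z - y < inverse (real (Suc n)) \<and> Q y z}"
  have "straddled Q t \<longleftrightarrow> (\<forall>n. t \<in> ?O n)" for t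
  proof
    assume t: "\<forall>n. t \<in> ?O n"
    show "straddled Q t"
      unfolding straddled_def
    proof (intro allI impI)
      fix e :: real assume "e > 0"
      then obtain n where n: "inverse (real (Suc n)) < e" using reals_Archimedean by blast
      obtain y z where "y < t" "t < z" "z - y < inverse (real (Suc n))" "Q y z" using t by blast
      then show "\<exists>y z. y < t \<and> t < z \<and> z - y < e \<and> Q y z" using n by (meson less_trans)
    qed
  qed (simp add: straddled_def)
  then have "{t. straddled Q t} = (\<Inter>n. ?O n)" by blast
  moreover have "open (?O n)" for n
    by (intro open_Collect_ex open_Collect_conj open_Collect_less open_Collect_const continuous_intros)
  ultimately show ?thesis by auto
qed

text \<open>
  The Vitali covering theorem yields countably many disjoint intervals that cover \<open>A\<close> up to a null
  set; finitely many of them already cover \<open>A\<close> up to measure \<open>\<tau>\<close>.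
\<close>
lemma Vitali_finite_intervals:
  assumes A: "A \<in> lmeasurable" and U: "open U" "A \<subseteq> U"
    and cov: "\<And>t. t \<in> A \<Longrightarrow> straddled Q t" and "\<tau> > 0"
  obtains P where "finite P" "\<forall>K\<in>P. \<exists>y z. y < z \<and> K = {y..z} \<and> Q y z \<and> K \<subseteq> U"
    "\<forall>K\<in>P. \<forall>L\<in>P. K \<noteq> L \<longrightarrow> K \<inter> L = {}" "P division_of \<Union>P"
    "measure lebesgue (A - \<Union>P) < \<tau>"
proof -
  define C0 where "C0 = {(m,\<rho>). \<rho> > 0 \<and> cball m \<rho> \<subseteq> U \<and> Q (m - \<rho>) (m + \<rho>)}"
  have fine: "\<exists>i. i \<in> C0 \<and> t \<in> cball (fst i) (snd i) \<and> snd i < e" if t: "t \<in> A" and e: "0 < e" for t e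
  proof -
    obtain k where k: "k > 0" "ball t k \<subseteq> U" using U t by (meson open_contains_ball subsetD)
    obtain y z where yz: "y < t" "t < z" "z - y < min e k" "Q y z"
      using cov[OF t] e k unfolding straddled_def by (metis min_less_iff_conj)
    have "cball ((y+z)/2) ((z-y)/2) = {y..z}" by (simp add: cball_eq_atLeastAtMost field_simps)
    moreover have "{y..z} \<subseteq> ball t k" using yz by (auto simp: dist_real_def)
    ultimately have "((y+z)/2, (z-y)/2) \<in> C0" "t \<in> cball ((y+z)/2) ((z-y)/2)" "(z-y)/2 < e"
      using yz k by (auto simp: C0_def field_simps)
    then show ?thesis by (intro exI[of _ "((y+z)/2, (z-y)/2)"]) simp
  qed
  have pos: "0 < snd i" if "i \<in> C0" for i using that by (auto simp: C0_def)
  obtain C where C: "countable C" "C \<subseteq> C0"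
     "pairwise (\<lambda>i j. disjnt (cball (fst i) (snd i)) (cball (fst j) (snd j))) C"
     "negligible(A - (\<Union>i \<in> C. cball (fst i) (snd i)))"
    by (rule Vitali_covering_theorem_cballs[of C0 snd A fst, OF pos fine])
  define B where "B i = cball (fst i) (snd i)" for i :: "real \<times> real"
  have lm: "A \<inter> B i \<in> lmeasurable" for i
    unfolding B_def using A by (auto intro!: fmeasurable.Int)
  obtain D where D: "finite D" "D \<subseteq> (\<lambda>i. A \<inter> B i) ` C"
      "measure lebesgue (\<Union>((\<lambda>i. A \<inter> B i) ` C)) - \<tau> < measure lebesgue (\<Union>D)"
  proof (rule measure_countable_Union_approachable[where \<D> = "(\<lambda>i. A \<inter> B i) ` C" and e = \<tau> and B = "measure lebesgue A"])
    show "countable ((\<lambda>i. A \<inter> B i) ` C)" using C by auto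
    show "d \<in> lmeasurable" if "d \<in> (\<lambda>i. A \<inter> B i) ` C" for d using that lm by auto
    show "measure lebesgue (\<Union>D') \<le> measure lebesgue A" if "D' \<subseteq> (\<lambda>i. A \<inter> B i) ` C" "finite D'" for D'
      by (rule measure_mono_fmeasurable) (use that lm A in \<open>auto intro!: sets.finite_Union\<close>)
  qed (use \<open>\<tau> > 0\<close> in auto)
  obtain C' where C': "C' \<subseteq> C" "finite C'" "D = (\<lambda>i. A \<inter> B i) ` C'"
    using finite_subset_image[OF D(1,2)] by auto
  have eqA: "measure lebesgue (\<Union>((\<lambda>i. A \<inter> B i) ` C)) = measure lebesgue A"
  proof -
    have "A = \<Union>((\<lambda>i. A \<inter> B i) ` C) \<union> (A - (\<Union>i\<in>C. B i))" by auto
    moreover have "measure lebesgue (\<Union>((\<lambda>i. A \<inter> B i) ` C) \<union> (A - (\<Union>i\<in>C. B i))) = measure lebesgue (\<Union>((\<lambda>i. A \<inter> B i) ` C))"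
    proof (rule measure_Un_null_set)
      show "\<Union>((\<lambda>i. A \<inter> B i) ` C) \<in> sets lebesgue"
        by (rule sets.countable_UN''[OF C(1)]) (use lm in blast)
      show "A - (\<Union>i\<in>C. B i) \<in> null_sets lebesgue"
        using C(4) by (simp add: negligible_iff_null_sets B_def)
    qed
    ultimately show ?thesis by simp
  qed
  show thesis
  proof
    let ?P = "B ` C'"
    show fP: "finite ?P" using C' by auto
    have int: "\<exists>y z. y < z \<and> K = {y..z} \<and> Q y z \<and> K \<subseteq> U" if "K \<in> ?P" for K
    proof -
      obtain i where "i \<in> C'" and i: "K = B i" using \<open>K \<in> ?P\<close> by (rule imageE)
      then have "i \<in> C0" using C'(1) C(2) by blast
      with i show ?thesis
        by (intro exI[of _ "fst i - snd i"] exI[of _ "fst i + snd i"])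
           (auto simp: C0_def B_def cball_eq_atLeastAtMost)
    qed
    then show "\<forall>K\<in>?P. \<exists>y z. y < z \<and> K = {y..z} \<and> Q y z \<and> K \<subseteq> U" by (rule ballI)
    have disj: "K1 \<inter> K2 = {}" if K: "K1 \<in> ?P" "K2 \<in> ?P" "K1 \<noteq> K2" for K1 K2
    proof -
      obtain i j where ij: "i \<in> C'" "j \<in> C'" "K1 = B i" "K2 = B j" using K(1,2) by blast
      then have "i \<noteq> j" "i \<in> C" "j \<in> C" using K(3) C'(1) by auto
      then have "disjnt (B i) (B j)" using pairwiseD[OF C(3)] unfolding B_def by blast
      then show ?thesis using ij by (simp add: disjnt_def)
    qed
    then show "\<forall>K\<in>?P. \<forall>L\<in>?P. K \<noteq> L \<longrightarrow> K \<inter> L = {}" by blast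
    show "?P division_of \<Union>?P"
    proof (rule division_ofI)
      fix K assume "K \<in> ?P"
      then show "K \<noteq> {}" "\<exists>a b. K = cbox a b" using int[of K] by auto
    next
      fix K1 K2 assume "K1 \<in> ?P" "K2 \<in> ?P" "K1 \<noteq> K2"
      then show "interior K1 \<inter> interior K2 = {}" using disj interior_subset by blast
    qed (use fP in auto)
    have "measure lebesgue (A - \<Union>?P) = measure lebesgue A - measure lebesgue (\<Union>D)"
    proof -
      have lD: "\<Union>D \<in> lmeasurable"
        unfolding C'(3) by (rule fmeasurable.finite_Union) (use C'(2) lm in auto)
      have *: "A - \<Union>?P = A - \<Union>D" using C' by auto
      show ?thesis unfolding *
        by (rule measure_Diff[OF _ fmeasurableD[OF A] fmeasurableD[OF lD]]) (use C' fmeasurableD2[OF A] in auto)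
    qed
    then show "measure lebesgue (A - \<Union>?P) < \<tau>" using D(3) eqA by linarith
  qed
qed

lemma additive_division_1:
  fixes f :: "real \<Rightarrow> 'a::real_normed_vector"
  assumes "a \<le> b" and p: "p division_of {a..b}"
  shows "(\<Sum>K\<in>p. f (Sup K) - f (Inf K)) = f b - f a"
proof -
  let ?f = "(\<lambda>K::real set. if K = {} then 0 else f (Sup K) - f (Inf K))"
  interpret operative_real plus 0 ?f
    rewrites "comm_monoid_set.F (+) 0 = sum"
    by standard[1] (auto simp add: sum_def)
  have "sum ?f p = ?f (cbox a b)"
    using division[of p a b] p by simp
  moreover have "sum ?f p = (\<Sum>K\<in>p. f (Sup K) - f (Inf K))"
    using division_ofD(3)[OF p] by (intro sum.cong) auto
  ultimately show ?thesis using \<open>a \<le> b\<close> by simp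
qed

section \<open>Absolutely continuous functions are differentiable almost everywhere\<close>

text \<open>
  Real functions enter below through their complexification, since absolute continuity is a notion for
  complex functions here.
\<close>
lemma AC_of_real_D:
  assumes "abs_cont_on S (\<lambda>t. complex_of_real (F t))" "\<epsilon> > 0"
  obtains \<delta> where "\<delta> > 0" "\<forall>\<D>. \<D> division_of \<Union>\<D> \<and> \<Union>\<D> \<subseteq> S \<and> (\<Sum>K\<in>\<D>. Sup K - Inf K) < \<delta> \<longrightarrow>
      (\<Sum>K\<in>\<D>. \<bar>F (Sup K) - F (Inf K)\<bar>) < \<epsilon>"
proof -
  have n: "norm (complex_of_real x - of_real y) = \<bar>x - y\<bar>" for x y
    by (metis norm_of_real of_real_diff)
  show thesis
    using assms that unfolding abs_cont_on_def n by metis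
qed

lemma division_sum_measure:
  fixes P :: "real set set"
  assumes "P division_of S"
  shows "(\<Sum>K\<in>P. Sup K - Inf K) = measure lebesgue S"
proof -
  have "(\<Sum>K\<in>P. Sup K - Inf K) = sum (measure lborel) P"
  proof (rule sum.cong)
    fix K assume "K \<in> P"
    then obtain a b where "K = {a..b}" "a \<le> b" using division_ofD(3,4)[OF assms] by (metis atLeastatMost_empty_iff cbox_interval)
    then show "Sup K - Inf K = measure lborel K" by auto
  qed auto
  also have "\<dots> = sum (measure lebesgue) P"
  proof (rule sum.cong)
    fix K assume "K \<in> P"
    then obtain a b where "K = {a..b}" using division_ofD(4)[OF assms] by (metis cbox_interval)
    then have "K \<in> sets lborel" by simp
    then show "measure lborel K = measure lebesgue K" by (simp only: measure_completion)
  qed simp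
  also have "\<dots> = measure lebesgue S" by (rule content_division[OF assms])
  finally show ?thesis .
qed

text \<open>
  Let \<open>A\<close> be the set in question, and cover it twice: first, inside an open set barely larger than
  \<open>A\<close>, by disjoint intervals \<open>K\<close> with slope below \<open>r\<close>, and then, inside each \<open>K\<close>, by disjoint
  intervals with slope above \<open>s\<close>. What is left of the intervals \<open>K\<close> after removing the second family is a finite
  union of intervals of small total length, so by absolute continuity the increments of \<open>F\<close> over
  it are negligible. Thus the total increment over all \<open>K\<close> is below \<open>r |A|\<close> and above \<open>s |A|\<close> up
  to small errors, which forces \<open>|A| = 0\<close>.
\<close>
lemma AC_crossing_slopes_negligible:
  fixes F :: "real \<Rightarrow> real"
  assumes ac: "abs_cont_on {c..d} (\<lambda>t. complex_of_real (F t))" and "r < s"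
  shows "negligible {t. straddled (\<lambda>y z. c \<le> y \<and> z \<le> d \<and> F z - F y < r * (z - y)) t \<and>
                        straddled (\<lambda>y z. c \<le> y \<and> z \<le> d \<and> F z - F y > s * (z - y)) t}"
    (is "negligible {t. straddled ?lo t \<and> straddled ?hi t}")
proof -
  define A where "A = {t. straddled ?lo t \<and> straddled ?hi t}"
  have A: "A \<in> lmeasurable"
  proof (rule bounded_set_imp_lmeasurable)
    have "A \<subseteq> {c..d}"
    proof
      fix t assume "t \<in> A"
      then have "straddled ?lo t" by (simp add: A_def)
      then obtain y z where "y < t" "t < z" "?lo y z" unfolding straddled_def by (metis zero_less_one)
      then show "t \<in> {c..d}" by auto
    qed
    then show "bounded A" by (meson bounded_closed_interval bounded_subset)
    have "A = {t. straddled ?lo t} \<inter> {t. straddled ?hi t}" by (auto simp: A_def)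
    then have "A \<in> sets borel" using sets.Int[OF sets_straddled sets_straddled] by simp
    then show "A \<in> sets lebesgue" by simp
  qed
  have key: "(s - r) * measure lebesgue A \<le> 2 * \<epsilon>" if "\<epsilon> > 0" for \<epsilon>
  proof -
    obtain \<delta> where "\<delta> > 0" and \<delta>: "\<forall>\<D>. \<D> division_of \<Union>\<D> \<and> \<Union>\<D> \<subseteq> {c..d} \<and> (\<Sum>K\<in>\<D>. Sup K - Inf K) < \<delta> \<longrightarrow>
      (\<Sum>K\<in>\<D>. \<bar>F (Sup K) - F (Inf K)\<bar>) < \<epsilon>"
      by (rule AC_of_real_D[OF ac \<open>\<epsilon> > 0\<close>])
    \<comment> \<open>The gaps will have total length below \<open>2 \<tau> \<le> \<delta>\<close>; the second bound absorbs the errors that are proportional to \<open>\<tau>\<close>.\<close>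
    define \<tau> where "\<tau> = min (\<delta>/2) (\<epsilon> / ((s - r) + 2 * \<bar>s\<bar>))"
    have "\<tau> > 0" using \<open>r < s\<close> \<open>\<delta> > 0\<close> \<open>\<epsilon> > 0\<close> by (auto simp: \<tau>_def intro!: divide_pos_pos)
    have "\<tau> \<le> \<epsilon> / ((s - r) + 2 * \<bar>s\<bar>)" by (simp add: \<tau>_def)
    then have \<tau>\<epsilon>: "\<tau> * ((s - r) + 2 * \<bar>s\<bar>) \<le> \<epsilon>" using \<open>r < s\<close> by (simp add: pos_le_divide_eq)
    obtain U where U: "open U" "A \<subseteq> U" "U - A \<in> lmeasurable" "emeasure lebesgue (U - A) < ennreal \<tau>"
      using sets_lebesgue_outer_open[OF _ \<open>\<tau> > 0\<close>, of A] A by blast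
    have UA: "measure lebesgue (U - A) < \<tau>"
      using U(3,4) \<open>\<tau> > 0\<close> by (simp add: emeasure_eq_measure2 ennreal_less_iff)
    have lo: "straddled ?lo t" if "t \<in> A" for t using that by (simp add: A_def)
    obtain P where P': "finite P" "\<forall>K\<in>P. \<exists>y z. y < z \<and> K = {y..z} \<and> ?lo y z \<and> K \<subseteq> U"
       "\<forall>K\<in>P. \<forall>L\<in>P. K \<noteq> L \<longrightarrow> K \<inter> L = {}" "P division_of \<Union>P"
       "measure lebesgue (A - \<Union>P) < \<tau>"
      by (rule Vitali_finite_intervals[OF A U(1,2) lo \<open>\<tau> > 0\<close>])
    note P = P'(1) P'(2,3)[rule_format] P'(4,5)
    \<comment> \<open>Spends the tolerance \<open>\<tau>\<close> evenly on the intervals of the first family.\<close>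
    define \<tau>' where "\<tau>' = \<tau> / (card P + 1)"
    have "\<tau>' > 0" using \<open>\<tau> > 0\<close> by (simp add: \<tau>'_def add_nonneg_pos)
    have "\<exists>Q q. Q division_of \<Union>Q \<and> \<Union>Q \<subseteq> K \<and> Q \<subseteq> q \<and> q division_of K \<and>
        (\<forall>L\<in>Q. F (Sup L) - F (Inf L) \<ge> s * (Sup L - Inf L)) \<and> measure lebesgue (A \<inter> interior K - \<Union>Q) < \<tau>'"
      if "K \<in> P" for K
    proof -
      obtain y z where yz: "y < z" "K = {y..z}" using P(2) \<open>K \<in> P\<close> by blast
      have AK: "A \<inter> interior K \<in> lmeasurable" using A yz by (auto intro!: fmeasurable_Int_fmeasurable)
      have hi: "straddled ?hi t" if "t \<in> A \<inter> interior K" for t using that by (simp add: A_def)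
      obtain Q where Q': "finite Q" "\<forall>L\<in>Q. \<exists>y z. y < z \<and> L = {y..z} \<and> ?hi y z \<and> L \<subseteq> interior K"
         "\<forall>K\<in>Q. \<forall>L\<in>Q. K \<noteq> L \<longrightarrow> K \<inter> L = {}"
           "Q division_of \<Union>Q" "measure lebesgue (A \<inter> interior K - \<Union>Q) < \<tau>'"
        by (rule Vitali_finite_intervals[OF AK open_interior Int_lower2 hi \<open>\<tau>' > 0\<close>])
      note Q = Q'(1) Q'(2,3)[rule_format] Q'(4,5)
      have QK: "\<Union>Q \<subseteq> K" using Q(2) interior_subset by blast
      then obtain q where "Q \<subseteq> q" "q division_of K"
        using partial_division_extend_interval[OF Q(4), of y z] yz by auto
      moreover have "F (Sup L) - F (Inf L) \<ge> s * (Sup L - Inf L)" if "L \<in> Q" for L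
        using Q(2)[OF that] by auto
      ultimately show ?thesis using Q QK by blast
    qed
    then have "\<forall>K\<in>P. \<exists>Q q. Q division_of \<Union>Q \<and> \<Union>Q \<subseteq> K \<and> Q \<subseteq> q \<and> q division_of K \<and>
        (\<forall>L\<in>Q. F (Sup L) - F (Inf L) \<ge> s * (Sup L - Inf L)) \<and> measure lebesgue (A \<inter> interior K - \<Union>Q) < \<tau>'"
      by blast
    from bchoice[OF this] obtain Q where "\<forall>K\<in>P. \<exists>q. Q K division_of \<Union>(Q K) \<and> \<Union>(Q K) \<subseteq> K \<and> Q K \<subseteq> q \<and> q division_of K \<and>
        (\<forall>L\<in>Q K. F (Sup L) - F (Inf L) \<ge> s * (Sup L - Inf L)) \<and> measure lebesgue (A \<inter> interior K - \<Union>(Q K)) < \<tau>'"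
      by blast
    from bchoice[OF this] obtain q where q: "\<forall>K\<in>P. Q K division_of \<Union>(Q K) \<and> \<Union>(Q K) \<subseteq> K \<and> Q K \<subseteq> q K \<and> q K division_of K \<and>
        (\<forall>L\<in>Q K. F (Sup L) - F (Inf L) \<ge> s * (Sup L - Inf L)) \<and> measure lebesgue (A \<inter> interior K - \<Union>(Q K)) < \<tau>'"
      by blast
    have Q: "Q K division_of \<Union>(Q K)" "\<Union>(Q K) \<subseteq> K" "Q K \<subseteq> q K" "q K division_of K"
        "\<forall>L\<in>Q K. F (Sup L) - F (Inf L) \<ge> s * (Sup L - Inf L)"
        "measure lebesgue (A \<inter> interior K - \<Union>(Q K)) < \<tau>'" if "K \<in> P" for K
      using bspec[OF q that] by blast+
    let ?len = "\<lambda>\<D>. \<Sum>K\<in>\<D>. Sup K - Inf (K::real set)"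
    let ?inc = "\<lambda>\<D>. \<Sum>K\<in>\<D>. F (Sup K) - F (Inf K)"
    \<comment> \<open>The gaps of the second family in \<open>K\<close>, as intervals.\<close>
    define R where "R K = q K - Q K" for K
    define RR where "RR = (\<Union>K\<in>P. R K)"
    have finq: "finite (q K)" if "K \<in> P" for K using Q(4)[OF that] by auto
    have RKsub: "L \<subseteq> K" if "K \<in> P" "L \<in> R K" for K L
      using division_ofD(2)[OF Q(4)] that by (auto simp: R_def)
    have disjP: "K1 \<inter> K2 = {}" if "K1 \<in> P" "K2 \<in> P" "K1 \<noteq> K2" for K1 K2
      using P(3) that by blast
    have RRdiv: "RR division_of \<Union>RR"
    proof (rule division_ofI)
      show "finite RR" using P finq by (auto simp: RR_def R_def)
      fix L assume "L \<in> RR"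
      then show "L \<subseteq> \<Union>RR" "L \<noteq> {}" "\<exists>a b. L = cbox a b"
        using division_ofD(3,4)[OF Q(4)] by (auto simp: RR_def R_def)
    next
      fix L1 L2 assume L: "L1 \<in> RR" "L2 \<in> RR" "L1 \<noteq> L2"
      then obtain K1 K2 where K: "K1 \<in> P" "K2 \<in> P" "L1 \<in> R K1" "L2 \<in> R K2" by (auto simp: RR_def)
      show "interior L1 \<inter> interior L2 = {}"
      proof (cases "K1 = K2")
        case True
        then show ?thesis using K L division_ofD(5)[OF Q(4)[OF K(1)], of L1 L2] by (auto simp: R_def)
      next
        case False
        then have "L1 \<inter> L2 = {}" using disjP[OF K(1,2)] RKsub[OF K(1,3)] RKsub[OF K(2,4)] by blast
          then show ?thesis using interior_subset by blast
      qed
    qed auto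
    have PU: "\<Union>P \<subseteq> U" using P(2) by blast
    have Pcd: "\<Union>P \<subseteq> {c..d}"
    proof
      fix t assume "t \<in> \<Union>P"
      then obtain K where K: "K \<in> P" "t \<in> K" by blast
      then show "t \<in> {c..d}" using P(2)[OF K(1)] by auto
    qed
    have lmP: "K \<in> lmeasurable" if "K \<in> P" for K
    proof -
      obtain y z where "K = {y..z}" using P(2)[OF \<open>K \<in> P\<close>] by blast
      then show ?thesis by simp
    qed
    have split_len: "?len (R K) = Sup K - Inf K - ?len (Q K)" 
     and split_inc: "?inc (R K) = F (Sup K) - F (Inf K) - ?inc (Q K)" if KP: "K \<in> P" for K
    proof -
      obtain y z where yz: "y < z" "K = {y..z}" using P(2)[OF KP] by blast
      then have dv: "q K division_of {y..z}" using Q(4)[OF KP] by simp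
      have "?len (q K) = Sup K - Inf K" "?inc (q K) = F (Sup K) - F (Inf K)"
        using additive_division_1[OF _ dv, of "\<lambda>t. t"] additive_division_1[OF _ dv, of F] yz by simp_all
      moreover have "?len (q K) = ?len (Q K) + ?len (R K)" "?inc (q K) = ?inc (Q K) + ?inc (R K)"
        unfolding R_def by (simp_all add: sum.subset_diff[OF Q(3)[OF KP] finq[OF KP]])
      ultimately show "?len (R K) = Sup K - Inf K - ?len (Q K)"
         "?inc (R K) = F (Sup K) - F (Inf K) - ?inc (Q K)" by linarith+
    qed
    have lenR: "?len (R K) \<le> measure lebesgue (K - A) + \<tau>'" if K: "K \<in> P" for K
    proof -
      obtain y z where yz: "y < z" "K = {y..z}" using P(2)[OF K] by blast
      have mQ: "measure lebesgue (\<Union>(Q K)) = ?len (Q K)" using division_sum_measure[OF Q(1)[OF K]] by simp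
      have lQ: "\<Union>(Q K) \<in> lmeasurable" using Q(1)[OF K] by (meson lmeasurable_division)
      have lm: "K - A \<in> lmeasurable" "A \<inter> interior K - \<Union>(Q K) \<in> lmeasurable" "\<Union>(Q K) \<in> lmeasurable" "{y,z} \<in> lmeasurable"
        using fmeasurable.Diff[OF lmP[OF K] A] fmeasurable.Diff[OF fmeasurable_Int_fmeasurable[OF A] lQ, of "interior K"] lQ
        by (simp_all add: negligible_imp_measurable)
      have "K \<subseteq> (K - A) \<union> ((A \<inter> interior K - \<Union>(Q K)) \<union> (\<Union>(Q K) \<union> {y,z}))"
        using yz by auto
      then have "measure lebesgue K \<le> measure lebesgue ((K - A) \<union> ((A \<inter> interior K - \<Union>(Q K)) \<union> (\<Union>(Q K) \<union> {y,z})))"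
        by (rule measure_mono_fmeasurable) (intro fmeasurable.Un fmeasurableD lm lmP K)+
      also have "\<dots> \<le> measure lebesgue (K - A) + (measure lebesgue (A \<inter> interior K - \<Union>(Q K)) + (measure lebesgue (\<Union>(Q K)) + measure lebesgue {y,z}))"
        by (intro order_trans[OF measure_Un_le] add_left_mono sets.Un lm[THEN fmeasurableD] order_refl)
      also have "measure lebesgue {y,z} = 0" by (rule negligible_imp_measure0) simp
      finally show ?thesis using split_len[OF K] Q(6)[OF K] mQ yz by simp
    qed
    have sum_R: "sum h RR = (\<Sum>K\<in>P. sum h (R K))" for h :: "real set \<Rightarrow> real"
      unfolding RR_def
    proof (rule sum.UNION_disjoint)
      show "finite P" by fact
      show "\<forall>K\<in>P. finite (R K)" using finq by (auto simp: R_def)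
      show "\<forall>K1\<in>P. \<forall>K2\<in>P. K1 \<noteq> K2 \<longrightarrow> R K1 \<inter> R K2 = {}"
      proof (intro ballI impI equals0I)
        fix K1 K2 L assume *: "K1 \<in> P" "K2 \<in> P" "K1 \<noteq> K2" "L \<in> R K1 \<inter> R K2"
        then have "L \<subseteq> K1 \<inter> K2" "L \<noteq> {}"
          using RKsub division_ofD(3)[OF Q(4)] by (auto simp: R_def)
        then show False using disjP * by blast
      qed
    qed
    have lmKA: "K - A \<in> lmeasurable" if KP: "K \<in> P" for K using lmP[OF KP] A by (rule fmeasurable.Diff)
    have "(\<Sum>K\<in>P. measure lebesgue (K - A)) = measure lebesgue (\<Union>K\<in>P. K - A)"
    proof (rule measure_finite_Union[symmetric])
      show "disjoint_family_on (\<lambda>K. K - A) P" using disjP by (auto simp: disjoint_family_on_def)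
      show "(\<lambda>K. K - A) ` P \<subseteq> sets lebesgue" using lmKA fmeasurableD by blast
      show "\<And>K. K \<in> P \<Longrightarrow> emeasure lebesgue (K - A) \<noteq> \<infinity>"
        using fmeasurableD2[OF lmKA] unfolding infinity_ennreal_def by blast
    qed fact
    also have "\<dots> \<le> measure lebesgue (U - A)"
      
    proof (rule measure_mono_fmeasurable[OF _ _ U(3)])
      show "(\<Union>K\<in>P. K - A) \<in> sets lebesgue" by (rule sets.finite_UN[OF P(1)]) (rule fmeasurableD[OF lmKA])
    qed (use PU in blast)
    finally have PA: "(\<Sum>K\<in>P. measure lebesgue (K - A)) < \<tau>" using UA by simp
    have lenRR: "?len RR < 2 * \<tau>"
    proof -
      have "?len RR \<le> (\<Sum>K\<in>P. measure lebesgue (K - A) + \<tau>')"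
        unfolding sum_R by (intro sum_mono lenR)
      also have "\<dots> = (\<Sum>K\<in>P. measure lebesgue (K - A)) + card P * \<tau>'" by (simp add: sum.distrib)
      also have "card P * \<tau>' \<le> \<tau>" using \<open>\<tau> > 0\<close> by (simp add: \<tau>'_def field_simps)
      finally show ?thesis using PA by simp
    qed
    have "\<Union>RR \<subseteq> {c..d}" using RKsub Pcd by (fastforce simp: RR_def)
    moreover have "?len RR < \<delta>" using lenRR by (simp add: \<tau>_def)
    ultimately have "(\<Sum>K\<in>RR. \<bar>F (Sup K) - F (Inf K)\<bar>) < \<epsilon>" using \<delta> RRdiv by blast
    then have incRR: "- ?inc RR \<le> \<epsilon>"
      using sum_abs[of "\<lambda>K. F (Sup K) - F (Inf K)" RR] by linarith
    have "?len RR \<ge> 0" using division_sum_measure[OF RRdiv] by simp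
    then have "s * ?len RR \<le> \<bar>s\<bar> * (2 * \<tau>)" using lenRR by (intro mult_mono) auto
    moreover have "(s - r) * ?len P \<le> s * ?len RR - ?inc RR"
    proof -
      have "(s - r) * (Sup K - Inf K) \<le> s * ?len (R K) - ?inc (R K)" if K: "K \<in> P" for K
      proof -
        obtain y z where yz: "y < z" "K = {y..z}" "F z - F y < r * (z - y)" using P(2)[OF K] by blast
        have "s * ?len (Q K) \<le> ?inc (Q K)"
          unfolding sum_distrib_left using Q(5)[OF K] by (intro sum_mono) auto
        moreover have "F (Sup K) - F (Inf K) < r * (Sup K - Inf K)" using yz by simp
        ultimately show ?thesis unfolding split_len[OF K] split_inc[OF K] by (simp add: algebra_simps)
      qed
      then show ?thesis
        unfolding sum_R sum_distrib_left sum_subtractf[symmetric] by (rule sum_mono)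
    qed
    moreover have "?len P = measure lebesgue (\<Union>P)" by (rule division_sum_measure[OF P(4)])
    moreover have "measure lebesgue A \<le> measure lebesgue (A - \<Union>P) + measure lebesgue (\<Union>P)"
    proof -
      have lP: "\<Union>P \<in> lmeasurable" using P(4) by (rule lmeasurable_division)
      have "measure lebesgue A \<le> measure lebesgue ((A - \<Union>P) \<union> \<Union>P)"
        by (rule measure_mono_fmeasurable) (use A lP in \<open>auto intro!: fmeasurable.Un fmeasurable.Diff\<close>)
      also have "\<dots> \<le> measure lebesgue (A - \<Union>P) + measure lebesgue (\<Union>P)"
        by (rule measure_Un_le) (use A lP in \<open>auto simp: fmeasurableD\<close>)
      finally show ?thesis .
    qed
    ultimately have "(s - r) * measure lebesgue A \<le> (s - r) * \<tau> + \<bar>s\<bar> * (2 * \<tau>) + \<epsilon>"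
      using incRR P(5) \<open>r < s\<close> mult_left_mono[of "measure lebesgue A" "\<tau> + measure lebesgue (\<Union>P)" "s - r"]
      by (simp add: algebra_simps)
    also have "\<dots> \<le> 2 * \<epsilon>" using \<tau>\<epsilon> by (simp add: algebra_simps)
    finally show ?thesis .
  qed
  have "(s - r) * measure lebesgue A \<le> 0"
    by (rule field_le_epsilon) (use key[of "e/2" for e] in auto)
  then have "measure lebesgue A = 0" using \<open>r < s\<close> by (simp add: mult_le_0_iff measure_le_0_iff)
  then show ?thesis using A by (simp add: negligible_iff_measure0 A_def)
qed

text \<open>
  Let \<open>\<delta>\<close> witness absolute continuity for \<open>\<epsilon> = 1\<close>. Inside an interval shorter than \<open>\<delta>\<close>, the increments over
  disjoint intervals add up to less than \<open>1\<close>. If the set had positive measure \<open>m\<close> there, steep intervals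
  covering half of this measure would have total increment at least \<open>k m / 2\<close>, for every \<open>k\<close>.
\<close>
lemma AC_infinite_slope_negligible:
  fixes F :: "real \<Rightarrow> real"
  assumes ac: "abs_cont_on {c..d} (\<lambda>t. complex_of_real (F t))"
  shows "negligible {t. \<forall>k::nat. straddled (\<lambda>y z. c \<le> y \<and> z \<le> d \<and> F z - F y > real k * (z - y)) t}"
    (is "negligible {t. \<forall>k. straddled (?Q k) t}")
proof -
  define A where "A = {t. \<forall>k. straddled (?Q k) t}"
  have "A = (\<Inter>k. {t. straddled (?Q k) t})" by (auto simp: A_def)
  moreover have "(\<Inter>k. {t. straddled (?Q k) t}) \<in> sets borel"
    by (rule sets.countable_INT) (auto simp: sets_straddled)
  ultimately have A: "A \<in> sets lebesgue" by simp
  obtain \<delta> where "\<delta> > 0" and \<delta>: "\<forall>\<D>. \<D> division_of \<Union>\<D> \<and> \<Union>\<D> \<subseteq> {c..d} \<and> (\<Sum>K\<in>\<D>. Sup K - Inf K) < \<delta> \<longrightarrow>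
      (\<Sum>K\<in>\<D>. \<bar>F (Sup K) - F (Inf K)\<bar>) < 1"
    by (rule AC_of_real_D[OF ac zero_less_one])
  have neg: "negligible (A \<inter> {u<..<u+\<delta>/2})" for u
  proof (rule ccontr)
    let ?J = "{u<..<u+\<delta>/2}"
    assume nn: "\<not> negligible (A \<inter> ?J)"
    have lm: "A \<inter> ?J \<in> lmeasurable" 
      using fmeasurable_Int_fmeasurable[OF _ A, of ?J] by (simp add: Int_commute)
    define m where "m = measure lebesgue (A \<inter> ?J)"
    have "m \<noteq> 0" using nn negligible_iff_measure0[OF lm] by (simp add: m_def)
    then have "m > 0" by (simp add: m_def less_le)
    obtain k :: nat where k: "2 / m < real k" using reals_Archimedean2 by blast
    have cov: "straddled (?Q k) t" if "t \<in> A \<inter> ?J" for t using that by (simp add: A_def)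
    have m2: "m / 2 > 0" using \<open>m > 0\<close> by simp
    obtain P where P': "finite P" "\<forall>K\<in>P. \<exists>y z. y < z \<and> K = {y..z} \<and> ?Q k y z \<and> K \<subseteq> ?J"
      "\<forall>K\<in>P. \<forall>L\<in>P. K \<noteq> L \<longrightarrow> K \<inter> L = {}" "P division_of \<Union>P"
      "measure lebesgue (A \<inter> ?J - \<Union>P) < m / 2"
      by (rule Vitali_finite_intervals[OF lm open_greaterThanLessThan Int_lower2 cov m2])
    note P = P'(1) P'(2,3)[rule_format] P'(4,5)
    let ?len = "\<Sum>K\<in>P. Sup K - Inf (K::real set)"
    have lenP: "?len = measure lebesgue (\<Union>P)" by (rule division_sum_measure[OF P(4)])
    have lP: "\<Union>P \<in> lmeasurable" using P(4) by (rule lmeasurable_division)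
    have "\<Union>P \<subseteq> ?J" using P(2) by blast
    then have "measure lebesgue (\<Union>P) \<le> measure lebesgue ?J"
      by (rule measure_mono_fmeasurable) (use lP in auto)
    then have "?len < \<delta>" using lenP \<open>\<delta> > 0\<close> by simp
    moreover have "\<Union>P \<subseteq> {c..d}"
    proof
      fix t assume "t \<in> \<Union>P"
      then obtain K where K: "K \<in> P" "t \<in> K" by blast
      then show "t \<in> {c..d}" using P(2)[OF K(1)] by auto
    qed
    ultimately have "(\<Sum>K\<in>P. \<bar>F (Sup K) - F (Inf K)\<bar>) < 1" using \<delta> P(4) by blast
    moreover have "real k * ?len \<le> (\<Sum>K\<in>P. \<bar>F (Sup K) - F (Inf K)\<bar>)"
      unfolding sum_distrib_left
    proof (rule sum_mono)
      fix K assume K: "K \<in> P"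
      obtain y z where "y < z" "K = {y..z}" "F z - F y > real k * (z - y)" using P(2)[OF K] by blast
      then show "real k * (Sup K - Inf K) \<le> \<bar>F (Sup K) - F (Inf K)\<bar>" by simp
    qed
    moreover
    have "m \<le> measure lebesgue (A \<inter> ?J - \<Union>P) + measure lebesgue (\<Union>P)"
    proof -
      have "m \<le> measure lebesgue ((A \<inter> ?J - \<Union>P) \<union> \<Union>P)"
        unfolding m_def by (rule measure_mono_fmeasurable[OF _ fmeasurableD[OF lm]])
          (use lm lP in \<open>auto intro!: fmeasurable.Un fmeasurable.Diff\<close>)
      also have "\<dots> \<le> measure lebesgue (A \<inter> ?J - \<Union>P) + measure lebesgue (\<Union>P)"
        by (rule measure_Un_le) (use lm lP in \<open>auto simp: fmeasurableD\<close>)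
      finally show ?thesis .
    qed
    then have "m / 2 \<le> ?len" using P(5) lenP by linarith
    then have "real k * (m / 2) \<le> real k * ?len" by (rule mult_left_mono) simp
    ultimately have "real k * (m / 2) < 1" by linarith
    moreover have "2 < real k * m" using k \<open>m > 0\<close> by (simp only: pos_divide_less_eq)
    ultimately show False by simp
  qed
  have "negligible A"
  proof (subst locally_negligible_alt, intro ballI exI conjI)
    fix t assume "t \<in> A"
    let ?U = "A \<inter> {t-\<delta>/4<..<t-\<delta>/4+\<delta>/2}"
    show "openin (top_of_set A) ?U" by (rule openin_open_Int) simp
    show "t \<in> ?U" using \<open>t \<in> A\<close> \<open>\<delta> > 0\<close> by simp
    show "negligible ?U" by (rule neg)
  qed
  then show ?thesis by (simp add: A_def)
qed

lemma abs_cont_on_norm_le: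
  assumes "abs_cont_on S f" "\<And>s t. norm (g s - g t) \<le> norm (f s - f t)"
  shows "abs_cont_on S g"
  unfolding abs_cont_on_def
proof (intro allI impI)
  fix \<epsilon> :: real assume "\<epsilon> > 0"
  then obtain \<delta> where "\<delta> > 0" and \<delta>: "\<And>\<D> T. \<D> division_of T \<and> T \<subseteq> S \<and> (\<Sum>K\<in>\<D>. Sup K - Inf K) < \<delta>
     \<Longrightarrow> (\<Sum>K\<in>\<D>. norm (f (Sup K) - f (Inf K))) < \<epsilon>"
    using assms(1) unfolding abs_cont_on_def by metis
  show "\<exists>\<delta>>0. \<forall>\<D> T. \<D> division_of T \<and> T \<subseteq> S \<and> (\<Sum>K\<in>\<D>. Sup K - Inf K) < \<delta>
      \<longrightarrow> (\<Sum>K\<in>\<D>. norm (g (Sup K) - g (Inf K))) < \<epsilon>"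
  proof (intro exI[of _ \<delta>] conjI allI impI \<open>\<delta> > 0\<close>)
    fix \<D> :: "real set set" and T assume "\<D> division_of T \<and> T \<subseteq> S \<and> (\<Sum>K\<in>\<D>. Sup K - Inf K) < \<delta>"
    then have "(\<Sum>K\<in>\<D>. norm (f (Sup K) - f (Inf K))) < \<epsilon>" by (rule \<delta>)
    moreover have "(\<Sum>K\<in>\<D>. norm (g (Sup K) - g (Inf K))) \<le> (\<Sum>K\<in>\<D>. norm (f (Sup K) - f (Inf K)))"
      by (intro sum_mono assms(2))
    ultimately show "(\<Sum>K\<in>\<D>. norm (g (Sup K) - g (Inf K))) < \<epsilon>" by linarith
  qed
qed

lemma abs_cont_on_imp_continuous_on:
  assumes "abs_cont_on {c..d} f" shows "continuous_on {c..d} f"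
  unfolding continuous_on_iff
proof (intro ballI allI impI)
  fix t \<epsilon> :: real assume t: "t \<in> {c..d}" and "\<epsilon> > 0"
  then obtain \<delta> where "\<delta> > 0" and \<delta>: "\<And>\<D> T. \<D> division_of T \<and> T \<subseteq> {c..d} \<and> (\<Sum>K\<in>\<D>. Sup K - Inf K) < \<delta>
     \<Longrightarrow> (\<Sum>K\<in>\<D>. norm (f (Sup K) - f (Inf K))) < \<epsilon>"
    using assms(1) unfolding abs_cont_on_def by metis
  have *: "norm (f z - f y) < \<epsilon>" if "y \<le> z" "{y..z} \<subseteq> {c..d}" "z - y < \<delta>" for y z
  proof -
    have "{{y..z}} division_of {y..z}" using division_of_self[of y z] \<open>y \<le> z\<close> by simp
    then have "(\<Sum>K\<in>{{y..z}}. norm (f (Sup K) - f (Inf K))) < \<epsilon>"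
      using \<open>{y..z} \<subseteq> {c..d}\<close> \<open>y \<le> z\<close> \<open>z - y < \<delta>\<close> by (intro \<delta>[of _ "{y..z}"]) simp
    then show ?thesis using \<open>y \<le> z\<close> by simp
  qed
  have "dist (f s) (f t) < \<epsilon>" if s: "s \<in> {c..d}" "dist s t < \<delta>" for s
  proof (cases "s \<le> t")
    case True
    then have "norm (f t - f s) < \<epsilon>" using s t by (intro *) (auto simp: dist_real_def)
    then show ?thesis by (simp add: dist_norm norm_minus_commute)
  next
    case False
    then have "norm (f s - f t) < \<epsilon>" using s t by (intro *) (auto simp: dist_real_def)
    then show ?thesis by (simp add: dist_norm)
  qed
  then show "\<exists>\<delta>>0. \<forall>s\<in>{c..d}. dist s t < \<delta> \<longrightarrow> dist (f s) (f t) < \<epsilon>" using \<open>\<delta> > 0\<close> by blast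
qed

text \<open>
  Letting one end of the chord tend to \<open>t\<close> turns chords around \<open>t\<close> into chords ending at \<open>t\<close>.
\<close>
lemma derivative_from_straddling_chords:
  fixes F :: "real \<Rightarrow> real"
  assumes cont: "isCont F t"
    and chord: "\<And>\<epsilon>. \<epsilon> > 0 \<Longrightarrow> \<exists>e>0. \<forall>y z. y < t \<and> t < z \<and> z - y < e \<longrightarrow> \<bar>F z - F y - L * (z - y)\<bar> \<le> \<epsilon> * (z - y)"
  shows "(F has_real_derivative L) (at t)"
  unfolding has_field_derivative_def has_derivative_at_alt
proof (intro conjI allI impI)
  show "bounded_linear ((*) L)" by (rule bounded_linear_mult_right)
  fix \<epsilon> :: real assume "\<epsilon> > 0"
  then obtain e where "e > 0" and e: "\<And>y z. y < t \<Longrightarrow> t < z \<Longrightarrow> z - y < e \<Longrightarrow> \<bar>F z - F y - L * (z - y)\<bar> \<le> \<epsilon> * (z - y)"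
    using chord by blast
  have Fl: "(F \<longlongrightarrow> F t) (at_left t)" and Fr: "(F \<longlongrightarrow> F t) (at_right t)"
    using cont by (auto simp: continuous_at filterlim_at_split)
  have r: "\<bar>F z - F t - L * (z - t)\<bar> \<le> \<epsilon> * (z - t)" if z: "t < z" "z - t < e" for z
  proof (rule tendsto_le[of "at_left t" "\<lambda>y. \<epsilon> * (z - y)" _ "\<lambda>y. \<bar>F z - F y - L * (z - y)\<bar>"])
    have "eventually (\<lambda>y. y \<in> {z - e<..<t}) (at_left t)"
      by (rule eventually_at_leftI[of "z - e"]) (use z in auto)
    then show "eventually (\<lambda>y. \<bar>F z - F y - L * (z - y)\<bar> \<le> \<epsilon> * (z - y)) (at_left t)"
    proof eventually_elim
      case (elim y)
      then show ?case using e[of y z] z by simp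
    qed
  qed (auto intro!: tendsto_intros Fl)
  have l: "\<bar>F t - F y - L * (t - y)\<bar> \<le> \<epsilon> * (t - y)" if y: "y < t" "t - y < e" for y
  proof (rule tendsto_le[of "at_right t" "\<lambda>z. \<epsilon> * (z - y)" _ "\<lambda>z. \<bar>F z - F y - L * (z - y)\<bar>"])
    have "eventually (\<lambda>z. z \<in> {t<..<y + e}) (at_right t)"
      by (rule eventually_at_rightI[of _ "y + e"]) (use y in auto)
    then show "eventually (\<lambda>z. \<bar>F z - F y - L * (z - y)\<bar> \<le> \<epsilon> * (z - y)) (at_right t)"
    proof eventually_elim
      case (elim z)
      then show ?case using e[of y z] y by simp
    qed
  qed (auto intro!: tendsto_intros Fr)
  have "norm (F s - F t - L * (s - t)) \<le> \<epsilon> * norm (s - t)" if "norm (s - t) < e" for s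
  proof (cases s t rule: linorder_cases)
    case less
    have "\<bar>F s - F t - L * (s - t)\<bar> = \<bar>F t - F s - L * (t - s)\<bar>" by (simp add: abs_if algebra_simps)
    then show ?thesis using l[OF less] less that by simp
  next
    case greater
    then show ?thesis using r[OF greater] that by simp
  qed simp
  then show "\<exists>d>0. \<forall>s. norm (s - t) < d \<longrightarrow> norm (F s - F t - L * (s - t)) \<le> \<epsilon> * norm (s - t)"
    using \<open>e > 0\<close> by blast
qed

text \<open>
  Off the null sets of crossing slopes and of infinite slopes, for rational \<open>r < s\<close> all short chords around \<open>t\<close> have slope at least
  \<open>r\<close> or all have slope at most \<open>s\<close>. The supremum \<open>L\<close> of the eventual lower slope bounds is
  then finite and is the limit of the slopes.
\<close>
lemma real_AC_differentiable_ae: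
  fixes F :: "real \<Rightarrow> real"
  assumes ac: "abs_cont_on {c..d} (\<lambda>t. complex_of_real (F t))"
  shows "negligible {t \<in> {c<..<d}. \<not> (\<exists>D. (F has_real_derivative D) (at t))}"
proof -
  let ?up = "\<lambda>G s. straddled (\<lambda>y z. c \<le> y \<and> z \<le> d \<and> G z - G y > s * (z - y))"
  let ?lo = "\<lambda>s. straddled (\<lambda>y z. c \<le> y \<and> z \<le> d \<and> F z - F y < s * (z - y))"
  define N1 where "N1 = (\<Union>q\<in>{q :: rat \<times> rat. fst q < snd q}. {t. ?lo (of_rat (fst q)) t \<and> ?up F (of_rat (snd q)) t})"
  define N2 where "N2 = {t. \<forall>k::nat. ?up F (real k) t}"
  define N3 where "N3 = {t. \<forall>k::nat. ?up (\<lambda>t. - F t) (real k) t}"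
  have n1: "negligible N1"
    unfolding N1_def
    by (rule negligible_countable_Union)
       (auto intro!: AC_crossing_slopes_negligible[OF ac] simp: of_rat_less)
  have n2: "negligible N2"
    unfolding N2_def by (rule AC_infinite_slope_negligible[OF ac])
  have "abs_cont_on {c..d} (\<lambda>t. complex_of_real (- F t))"
    by (rule abs_cont_on_norm_le[OF ac]) (simp add: norm_minus_commute)
  then have n3: "negligible N3"
    unfolding N3_def by (rule AC_infinite_slope_negligible)
  have contF: "continuous_on {c..d} F"
    using continuous_on_Re[OF abs_cont_on_imp_continuous_on[OF ac]] by simp
  have "\<exists>D. (F has_real_derivative D) (at t)" if t: "c < t" "t < d" "t \<notin> N1" "t \<notin> N2" "t \<notin> N3" for t
  proof -
    define low where "low r \<longleftrightarrow> (\<exists>e>0. \<forall>y z. y < t \<and> t < z \<and> z - y < e \<longrightarrow> r * (z - y) \<le> F z - F y)" for r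
    define upp where "upp s \<longleftrightarrow> (\<exists>e>0. \<forall>y z. y < t \<and> t < z \<and> z - y < e \<longrightarrow> F z - F y \<le> s * (z - y))" for s
    define e0 where "e0 = min (t - c) (d - t)"
    have e0: "e0 > 0" "\<And>y z. y < t \<Longrightarrow> t < z \<Longrightarrow> z - y < e0 \<Longrightarrow> c \<le> y \<and> z \<le> d"
      using t by (auto simp: e0_def)
    have lowI: "low r" if "\<not> ?lo r t" for r
    proof -
      obtain e where "e > 0" "\<forall>y z. y < t \<and> t < z \<and> z - y < e \<longrightarrow> \<not> (c \<le> y \<and> z \<le> d \<and> F z - F y < r * (z - y))"
        using \<open>\<not> ?lo r t\<close> unfolding straddled_def by blast
      then show ?thesis
        unfolding low_def using e0 by (intro exI[of _ "min e e0"]) (auto simp: not_less)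
    qed
    have uppI: "upp s" if "\<not> ?up F s t" for s
    proof -
      obtain e where "e > 0" "\<forall>y z. y < t \<and> t < z \<and> z - y < e \<longrightarrow> \<not> (c \<le> y \<and> z \<le> d \<and> F z - F y > s * (z - y))"
        using \<open>\<not> ?up F s t\<close> unfolding straddled_def by blast
      then show ?thesis
        unfolding upp_def using e0 by (intro exI[of _ "min e e0"]) (auto simp: not_less)
    qed
    have dich: "low (of_rat r) \<or> upp (of_rat s)" if "r < s" for r s
      using \<open>t \<notin> N1\<close> that lowI uppI by (auto simp: N1_def)
    obtain k where k: "upp (real k)" using \<open>t \<notin> N2\<close> uppI by (auto simp: N2_def)
    obtain k' :: nat where k': "low (- real k')"
    proof -
      obtain j :: nat where "\<not> ?up (\<lambda>t. - F t) (real j) t" using \<open>t \<notin> N3\<close> by (auto simp: N3_def)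
      moreover have "(- F z - - F y > real j * (z - y)) = (F z - F y < - real j * (z - y))" for y z
        by (simp add: algebra_simps)
      ultimately have "low (- real j)" by (intro lowI) (simp only: simp_thms)
      then show thesis by (rule that)
    qed
    have mono: "r \<le> s" if "low r" "upp s" for r s
    proof -
      obtain e e' where e: "e > 0" "\<forall>y z. y < t \<and> t < z \<and> z - y < e \<longrightarrow> r * (z - y) \<le> F z - F y"
        "e' > 0" "\<forall>y z. y < t \<and> t < z \<and> z - y < e' \<longrightarrow> F z - F y \<le> s * (z - y)"
        using \<open>low r\<close> \<open>upp s\<close> unfolding low_def upp_def by blast
      define h where "h = min e e' / 3"
      have h: "h > 0" "2 * h < e" "2 * h < e'" using e(1,3) by (auto simp: h_def min_def)
      have "r * (2 * h) \<le> F (t + h) - F (t - h)"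
        using e(2)[rule_format, of "t - h" "t + h"] h by simp
      also have "\<dots> \<le> s * (2 * h)"
        using e(4)[rule_format, of "t - h" "t + h"] h by simp
      finally show ?thesis using h by simp
    qed
    define L where "L = Sup {r. low r}"
    have bdd: "bdd_above {r. low r}" using mono k by (auto simp: bdd_above_def)
    have "\<exists>e>0. \<forall>y z. y < t \<and> t < z \<and> z - y < e \<longrightarrow> \<bar>F z - F y - L * (z - y)\<bar> \<le> \<epsilon> * (z - y)" if "\<epsilon> > 0" for \<epsilon>
    proof -
      obtain r where r: "low r" "L - \<epsilon> < r"
        using less_cSupD[of "{r. low r}" "L - \<epsilon>"] k' \<open>\<epsilon> > 0\<close> by (auto simp: L_def)
      obtain q1 where q1: "L < of_rat q1" "of_rat q1 < L + \<epsilon>"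
        using of_rat_dense[of L "L + \<epsilon>"] \<open>\<epsilon> > 0\<close> by auto
      obtain q2 where q2: "real_of_rat q1 < of_rat q2" "of_rat q2 < L + \<epsilon>"
        using of_rat_dense[OF q1(2)] by auto
      have "\<not> low (of_rat q1)" using cSup_upper[OF _ bdd, of "of_rat q1"] q1 by (auto simp: L_def)
      then have "upp (of_rat q2)" using dich q2 by (auto simp: of_rat_less)
      then obtain e e' where e: "e > 0" "\<forall>y z. y < t \<and> t < z \<and> z - y < e \<longrightarrow> r * (z - y) \<le> F z - F y"
        "e' > 0" "\<forall>y z. y < t \<and> t < z \<and> z - y < e' \<longrightarrow> F z - F y \<le> of_rat q2 * (z - y)"
        using \<open>low r\<close> unfolding low_def upp_def by blast
      show ?thesis
      proof (intro exI[of _ "min e e'"] conjI allI impI)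
        fix y z assume yz: "y < t \<and> t < z \<and> z - y < min e e'"
        have "(L - \<epsilon>) * (z - y) \<le> r * (z - y)" "of_rat q2 * (z - y) \<le> (L + \<epsilon>) * (z - y)"
          using r q2 yz by (auto intro!: mult_right_mono)
        moreover have "r * (z - y) \<le> F z - F y" "F z - F y \<le> of_rat q2 * (z - y)" using e yz by auto
        ultimately have "(L - \<epsilon>) * (z - y) \<le> F z - F y" "F z - F y \<le> (L + \<epsilon>) * (z - y)" by linarith+
        then show "\<bar>F z - F y - L * (z - y)\<bar> \<le> \<epsilon> * (z - y)" by (simp add: abs_le_iff algebra_simps)
      qed (use e in auto)
    qed
    moreover have "isCont F t" using continuous_on_interior[OF contF] t by simp
    ultimately show ?thesis using derivative_from_straddling_chords by blast
  qed
  then have "{t \<in> {c<..<d}. \<not> (\<exists>D. (F has_real_derivative D) (at t))} \<subseteq> N1 \<union> N2 \<union> N3" by auto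
  then show ?thesis using n1 n2 n3 by (meson negligible_Un negligible_subset)
qed

lemma AC_differentiable_ae:
  assumes ac: "abs_cont_on {c..d} f"
  shows "negligible {t \<in> {c<..<d}. \<not> f differentiable (at t)}"
proof -
  have re: "abs_cont_on {c..d} (\<lambda>t. complex_of_real (Re (f t)))"
   and im: "abs_cont_on {c..d} (\<lambda>t. complex_of_real (Im (f t)))"
    using abs_Re_le_cmod[of "f s - f t" for s t] abs_Im_le_cmod[of "f s - f t" for s t]
    by (auto intro!: abs_cont_on_norm_le[OF ac] simp flip: of_real_diff)
  have "f differentiable (at t)"
    if "((\<lambda>t. Re (f t)) has_real_derivative D) (at t)" "((\<lambda>t. Im (f t)) has_real_derivative D') (at t)" for t D D'
  proof -
    have "(f has_vector_derivative Complex D D') (at t)"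
      using that by (simp add: has_vector_derivative_complex_iff has_real_derivative_iff_has_vector_derivative)
    then show ?thesis by (auto simp: has_vector_derivative_def differentiable_def)
  qed
  then have "{t \<in> {c<..<d}. \<not> f differentiable (at t)} \<subseteq>
     {t \<in> {c<..<d}. \<not> (\<exists>D. ((\<lambda>t. Re (f t)) has_real_derivative D) (at t))} \<union>
     {t \<in> {c<..<d}. \<not> (\<exists>D. ((\<lambda>t. Im (f t)) has_real_derivative D) (at t))}" by blast
  then show ?thesis
    using negligible_Un[OF real_AC_differentiable_ae[OF re] real_AC_differentiable_ae[OF im]] by (rule negligible_subset[rotated])
qed

section \<open>The fundamental theorem of calculus for absolutely continuous functions\<close>

text \<open>
  Choose the gauge at a point of differentiability such that the derivative approximates the
  increments, and at a point of \<open>N\<close> let it be an open set of measure below \<open>\<delta>\<close> that contains \<open>N\<close>. The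
  intervals tagged in \<open>N\<close> then have total length below \<open>\<delta>\<close>, so the increments over them are small
  by absolute continuity.
\<close>
lemma AC_fundamental_theorem_of_calculus:
  assumes ac: "abs_cont_on {c..d} F" and "c \<le> d" and N: "negligible N"
    and der: "\<And>t. t \<in> {c..d} - N \<Longrightarrow> (F has_vector_derivative \<phi> t) (at t within {c..d})"
  shows "(\<phi> has_integral (F d - F c)) {c..d}"
proof -
  \<comment> \<open>Changing the integrand to \<open>0\<close> on \<open>N\<close> removes the terms tagged in \<open>N\<close> from the Riemann sums.\<close>
  define \<psi> where "\<psi> t = (if t \<in> N then 0 else \<phi> t)" for t
  have "(\<psi> has_integral (F d - F c)) {c..d}"
    unfolding has_integral_real
  proof (intro allI impI)
    fix e :: real assume "e > 0"
    obtain \<delta> where "\<delta> > 0" and \<delta>: "\<And>\<D> T. \<D> division_of T \<and> T \<subseteq> {c..d} \<and> (\<Sum>K\<in>\<D>. Sup K - Inf K) < \<delta>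
      \<Longrightarrow> (\<Sum>K\<in>\<D>. norm (F (Sup K) - F (Inf K))) < e / 2"
      using ac \<open>e > 0\<close> unfolding abs_cont_on_def by (metis half_gt_zero)
    obtain U where U: "open U" "N \<subseteq> U" "U - N \<in> lmeasurable" "emeasure lebesgue (U - N) < ennreal \<delta>"
      using sets_lebesgue_outer_open[OF negligible_imp_sets[OF N] \<open>\<delta> > 0\<close>] by blast
    have lmU: "U \<in> lmeasurable"
    proof -
      have "U = (U - N) \<union> N" using U(2) by blast
      then show ?thesis using fmeasurable.Un[OF U(3) negligible_imp_measurable[OF N]] by simp
    qed
    have mU: "measure lebesgue U < \<delta>"
    proof -
      have "measure lebesgue (U - N) = measure lebesgue U"
        using N U(1) by (intro measure_Diff_null_set) (auto simp: negligible_iff_null_sets)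
      moreover have "measure lebesgue (U - N) < \<delta>"
        using U(3,4) \<open>\<delta> > 0\<close> by (simp add: emeasure_eq_measure2 ennreal_less_iff)
      ultimately show ?thesis by simp
    qed
    define e' where "e' = e / (4 * (d - c + 1))"
    have e': "e' > 0" "e' * (d - c) < e / 2"
      using \<open>e > 0\<close> \<open>c \<le> d\<close> by (auto simp: e'_def field_simps add_strict_increasing)
    have "\<exists>r>0. \<forall>s\<in>{c..d}. \<bar>s - t\<bar> < r \<longrightarrow> norm (F s - F t - (s - t) *\<^sub>R \<phi> t) \<le> e' * \<bar>s - t\<bar>"
      if t: "t \<in> {c..d} - N" for t
      using der[OF t] e'(1) unfolding has_vector_derivative_def has_derivative_within_alt by simp
    then have "\<forall>t. \<exists>r. t \<in> {c..d} - N \<longrightarrow> r > 0 \<and> (\<forall>s\<in>{c..d}. \<bar>s - t\<bar> < r \<longrightarrow> norm (F s - F t - (s - t) *\<^sub>R \<phi> t) \<le> e' * \<bar>s - t\<bar>)"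
      by blast
    from choice[OF this] obtain r where r: "\<forall>t. t \<in> {c..d} - N \<longrightarrow> r t > 0 \<and>
        (\<forall>s\<in>{c..d}. \<bar>s - t\<bar> < r t \<longrightarrow> norm (F s - F t - (s - t) *\<^sub>R \<phi> t) \<le> e' * \<bar>s - t\<bar>)" by blast
    define \<gamma> where "\<gamma> t = (if t \<in> N then U else if t \<in> {c..d} then ball t (r t) else UNIV)" for t
    have "gauge \<gamma>" using U r by (auto simp: gauge_def \<gamma>_def)
    moreover have "norm ((\<Sum>(t, K)\<in>p. measure lborel K *\<^sub>R \<psi> t) - (F d - F c)) < e"
      if p: "p tagged_division_of {c..d}" and fine: "\<gamma> fine p" for p
    proof -
      let ?inc = "\<lambda>K. F (Sup K) - F (Inf K)"
      define q where "q = {(t,K) \<in> p. t \<in> N}"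
      note pD = tagged_division_ofD[OF p]
      have qp: "q \<subseteq> p" by (auto simp: q_def)
      have "p tagged_partial_division_of {c..d}" using p by (simp add: tagged_division_of_def)
      then have qpart: "q tagged_partial_division_of {c..d}" by (rule tagged_partial_division_subset[OF _ qp])
      have KI: "\<exists>u v. u \<le> v \<and> K = {u..v} \<and> u \<in> {c..d} \<and> v \<in> {c..d} \<and> t \<in> {u..v}" if tK: "(t,K) \<in> p" for t K
      proof -
        obtain u v where "K = {u..v}" using pD(4)[OF tK] by auto
        then show ?thesis using pD(2,3)[OF tK] by (intro exI[of _ u] exI[of _ v]) auto
      qed
      have "(\<Sum>(t, K)\<in>p. measure lborel K *\<^sub>R \<psi> t) - (F d - F c) = (\<Sum>(t, K)\<in>p. measure lborel K *\<^sub>R \<psi> t - ?inc K)"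
        using additive_tagged_division_1[OF \<open>c \<le> d\<close> p, of F] by (simp add: sum_subtractf case_prod_unfold)
      also have "\<dots> = (\<Sum>(t, K)\<in>p - q. measure lborel K *\<^sub>R \<psi> t - ?inc K) + (\<Sum>(t, K)\<in>q. measure lborel K *\<^sub>R \<psi> t - ?inc K)"
        by (rule sum.subset_diff[OF qp pD(1)])
      also have "norm \<dots> \<le> norm (\<Sum>(t, K)\<in>p - q. measure lborel K *\<^sub>R \<psi> t - ?inc K) + norm (\<Sum>(t, K)\<in>q. measure lborel K *\<^sub>R \<psi> t - ?inc K)"
        by (rule norm_triangle_ineq)
      finally have split: "norm ((\<Sum>(t, K)\<in>p. measure lborel K *\<^sub>R \<psi> t) - (F d - F c)) \<le> norm (\<Sum>(t, K)\<in>p - q. measure lborel K *\<^sub>R \<psi> t - ?inc K) + norm (\<Sum>(t, K)\<in>q. measure lborel K *\<^sub>R \<psi> t - ?inc K)" .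
      have "norm (\<Sum>(t, K)\<in>p - q. measure lborel K *\<^sub>R \<psi> t - ?inc K) \<le> (\<Sum>(t, K)\<in>p - q. e' * measure lborel K)"
      proof (rule sum_norm_le)
        fix w assume w: "w \<in> p - q"
        obtain t K where tK: "w = (t,K)" by (cases w)
        then have tKp: "(t,K) \<in> p" "t \<notin> N" using w by (auto simp: q_def)
        obtain u v where uv: "u \<le> v" "K = {u..v}" "u \<in> {c..d}" "v \<in> {c..d}" "t \<in> {u..v}" using KI[OF tKp(1)] by blast
        have t: "t \<in> {c..d} - N" using uv tKp by auto
        have "K \<subseteq> ball t (r t)" using fine tKp t unfolding fine_def \<gamma>_def by fastforce
        then have "u \<in> ball t (r t)" "v \<in> ball t (r t)" using uv(1,2) by auto
        then have close: "\<bar>u - t\<bar> < r t" "\<bar>v - t\<bar> < r t" by (simp_all add: dist_real_def abs_minus_commute)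
        have rb: "\<forall>s\<in>{c..d}. \<bar>s - t\<bar> < r t \<longrightarrow> norm (F s - F t - (s - t) *\<^sub>R \<phi> t) \<le> e' * \<bar>s - t\<bar>"
          using r t by blast
        have abs: "\<bar>u - t\<bar> = t - u" "\<bar>v - t\<bar> = v - t" using uv(5) by auto
        have 1: "norm (F u - F t - (u - t) *\<^sub>R \<phi> t) \<le> e' * (t - u)" "norm (F v - F t - (v - t) *\<^sub>R \<phi> t) \<le> e' * (v - t)"
          using mp[OF bspec[OF rb uv(3)] close(1)] mp[OF bspec[OF rb uv(4)] close(2)] unfolding abs .
        have "measure lborel K *\<^sub>R \<psi> t - ?inc K = (F u - F t - (u - t) *\<^sub>R \<phi> t) - (F v - F t - (v - t) *\<^sub>R \<phi> t)"
          using uv t by (simp add: \<psi>_def algebra_simps)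
        also have "norm \<dots> \<le> e' * (t - u) + e' * (v - t)" using norm_triangle_ineq4 1 by (meson add_mono order_trans)
        also have "\<dots> = e' * measure lborel K" using uv by (simp add: algebra_simps)
        finally show "norm (case w of (t, K) \<Rightarrow> measure lborel K *\<^sub>R \<psi> t - ?inc K) \<le> (case w of (t, K) \<Rightarrow> e' * measure lborel K)"
          by (simp add: tK)
      qed
      also have "(\<Sum>(t, K)\<in>p - q. e' * measure lborel K) \<le> (\<Sum>(t, K)\<in>p. e' * measure lborel K)"
        using e'(1) pD(1) by (intro sum_mono2) auto
      also have "\<dots> = e' * (d - c)"
        using additive_content_tagged_division[of p c d] p \<open>c \<le> d\<close> by (simp add: sum_distrib_left[symmetric] case_prod_unfold)
      finally have good: "norm (\<Sum>(t, K)\<in>p - q. measure lborel K *\<^sub>R \<psi> t - ?inc K) \<le> e' * (d - c)" .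
      have "norm (\<Sum>(t, K)\<in>q. measure lborel K *\<^sub>R \<psi> t - ?inc K) \<le> (\<Sum>(t, K)\<in>q. norm (?inc K))"
        by (rule sum_norm_le) (auto simp: q_def \<psi>_def norm_minus_commute)
      also have "\<dots> = (\<Sum>(t, K)\<in>q. if K = {} then 0 else norm (?inc K))"
      proof (rule sum.cong)
        fix w assume "w \<in> q"
        then have "w \<in> p" using qp by blast
        then show "(case w of (t, K) \<Rightarrow> norm (?inc K)) = (case w of (t, K) \<Rightarrow> if K = {} then 0 else norm (?inc K))"
          using pD(2) by (cases w) auto
      qed simp
      also have "\<dots> = (\<Sum>K\<in>snd ` q. if K = {} then 0 else norm (?inc K))"
      proof (rule sum.over_tagged_division_lemma)
        show "q tagged_division_of \<Union>(snd ` q)"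
          by (rule tagged_partial_division_of_Union_self) (rule qpart)
        fix u v :: real assume "box u v = {}"
        then show "(if cbox u v = {} then 0 else norm (?inc (cbox u v))) = 0" by auto
      qed
      also have "\<dots> \<le> (\<Sum>K\<in>snd ` q. norm (?inc K))" by (intro sum_mono) auto
      also have "\<dots> < e / 2"
      proof (rule \<delta>, intro conjI)
        show dv: "snd ` q division_of \<Union>(snd ` q)"
          by (rule partial_division_of_tagged_division) (rule qpart)
        show "\<Union>(snd ` q) \<subseteq> {c..d}" using pD(3) qp by fastforce
        have "\<Union>(snd ` q) \<subseteq> U" using fine unfolding fine_def by (fastforce simp: q_def \<gamma>_def)
        then have "measure lebesgue (\<Union>(snd ` q)) \<le> measure lebesgue U"
          by (rule measure_mono_fmeasurable) (use dv lmU in \<open>auto intro: fmeasurableD lmeasurable_division\<close>)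
        then show "(\<Sum>K\<in>snd ` q. Sup K - Inf K) < \<delta>" using mU division_sum_measure[OF dv] by simp
      qed
      finally have bad: "norm (\<Sum>(t, K)\<in>q. measure lborel K *\<^sub>R \<psi> t - ?inc K) < e / 2" .
      have "norm ((\<Sum>(t, K)\<in>p. measure lborel K *\<^sub>R \<psi> t) - (F d - F c)) < e / 2 + e / 2"
        by (rule order.strict_trans1[OF split add_strict_mono[OF order.strict_trans1[OF good e'(2)] bad]])
      then show ?thesis by simp
    qed
    ultimately show "\<exists>\<gamma>. gauge \<gamma> \<and> (\<forall>\<D>. \<D> tagged_division_of {c..d} \<and> \<gamma> fine \<D> \<longrightarrow>
          norm ((\<Sum>(x, k)\<in>\<D>. measure lborel k *\<^sub>R \<psi> x) - (F d - F c)) < e)"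
      by (intro exI[of _ \<gamma>] conjI allI impI) simp_all
  qed
  then show ?thesis by (rule has_integral_spike[OF N, rotated]) (simp add: \<psi>_def)
qed

lemma division_endpoints:
  fixes K :: "real set"
  assumes "\<D> division_of T" "K \<in> \<D>" "T \<subseteq> S"
  shows "Sup K \<in> S" "Inf K \<in> S"
proof -
  obtain u v where "K = {u..v}" "u \<le> v"
    using division_ofD(3,4)[OF assms(1,2)] by (metis atLeastatMost_empty_iff cbox_interval)
  then show "Sup K \<in> S" "Inf K \<in> S" using division_ofD(2)[OF assms(1,2)] assms(3) by auto
qed

lemma abs_cont_on_dominated:
  assumes f: "abs_cont_on S f" and g: "abs_cont_on S g"
    and le: "\<And>s t. s \<in> S \<Longrightarrow> t \<in> S \<Longrightarrow> norm (h s - h t) \<le> B * norm (f s - f t) + B * norm (g s - g t)"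
    and "B > 0"
  shows "abs_cont_on S h"
  unfolding abs_cont_on_def
proof (intro allI impI)
  fix \<epsilon> :: real assume "\<epsilon> > 0"
  then have e2: "\<epsilon> / (2 * B) > 0" using \<open>B > 0\<close> by simp
  obtain \<delta>1 where "\<delta>1 > 0" and \<delta>1: "\<And>\<D> T. \<D> division_of T \<and> T \<subseteq> S \<and> (\<Sum>K\<in>\<D>. Sup K - Inf K) < \<delta>1
     \<Longrightarrow> (\<Sum>K\<in>\<D>. norm (f (Sup K) - f (Inf K))) < \<epsilon> / (2 * B)"
    using f e2 unfolding abs_cont_on_def by metis
  obtain \<delta>2 where "\<delta>2 > 0" and \<delta>2: "\<And>\<D> T. \<D> division_of T \<and> T \<subseteq> S \<and> (\<Sum>K\<in>\<D>. Sup K - Inf K) < \<delta>2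
     \<Longrightarrow> (\<Sum>K\<in>\<D>. norm (g (Sup K) - g (Inf K))) < \<epsilon> / (2 * B)"
    using g e2 unfolding abs_cont_on_def by metis
  show "\<exists>\<delta>>0. \<forall>\<D> T. \<D> division_of T \<and> T \<subseteq> S \<and> (\<Sum>K\<in>\<D>. Sup K - Inf K) < \<delta>
      \<longrightarrow> (\<Sum>K\<in>\<D>. norm (h (Sup K) - h (Inf K))) < \<epsilon>"
  proof (intro exI[of _ "min \<delta>1 \<delta>2"] conjI allI impI)
    fix \<D> :: "real set set" and T assume *: "\<D> division_of T \<and> T \<subseteq> S \<and> (\<Sum>K\<in>\<D>. Sup K - Inf K) < min \<delta>1 \<delta>2"
    have "(\<Sum>K\<in>\<D>. norm (h (Sup K) - h (Inf K))) \<le> (\<Sum>K\<in>\<D>. B * norm (f (Sup K) - f (Inf K)) + B * norm (g (Sup K) - g (Inf K)))"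
      using * by (intro sum_mono le) (auto intro: division_endpoints)
    also have "\<dots> = B * (\<Sum>K\<in>\<D>. norm (f (Sup K) - f (Inf K))) + B * (\<Sum>K\<in>\<D>. norm (g (Sup K) - g (Inf K)))"
      by (simp add: sum.distrib sum_distrib_left)
    also have "\<dots> < B * (\<epsilon> / (2 * B)) + B * (\<epsilon> / (2 * B))"
      by (intro add_strict_mono mult_strict_left_mono \<delta>1[of \<D> T] \<delta>2[of \<D> T] \<open>B > 0\<close>) (use * in auto)
    also have "\<dots> = \<epsilon>" using \<open>B > 0\<close> by simp
    finally show "(\<Sum>K\<in>\<D>. norm (h (Sup K) - h (Inf K))) < \<epsilon>" .
  qed (use \<open>\<delta>1 > 0\<close> \<open>\<delta>2 > 0\<close> in auto)
qed

lemma abs_cont_on_diff: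
  assumes "abs_cont_on S f" "abs_cont_on S g" shows "abs_cont_on S (\<lambda>t. f t - g t)"
proof (rule abs_cont_on_dominated[OF assms, where B = 1])
  fix s t
  have "f s - g s - (f t - g t) = (f s - f t) - (g s - g t)" by simp
  also have "norm \<dots> \<le> norm (f s - f t) + norm (g s - g t)" by (rule norm_triangle_ineq4)
  finally show "norm (f s - g s - (f t - g t)) \<le> 1 * norm (f s - f t) + 1 * norm (g s - g t)" by simp
qed simp

lemma abs_cont_on_mult:
  assumes f: "abs_cont_on {c..d} f" and g: "abs_cont_on {c..d} g"
  shows "abs_cont_on {c..d} (\<lambda>t. f t * g t)"
proof -
  have "bounded (f ` {c..d})" "bounded (g ` {c..d})"
    using abs_cont_on_imp_continuous_on[OF f] abs_cont_on_imp_continuous_on[OF g]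
    by (auto intro!: compact_imp_bounded compact_continuous_image)
  then obtain B1 B2 where B: "B1 > 0" "\<And>t. t \<in> {c..d} \<Longrightarrow> norm (f t) \<le> B1" "B2 > 0" "\<And>t. t \<in> {c..d} \<Longrightarrow> norm (g t) \<le> B2"
    unfolding bounded_pos by blast
  show ?thesis
  proof (rule abs_cont_on_dominated[OF f g, where B = "max B1 B2"])
    fix s t assume st: "s \<in> {c..d}" "t \<in> {c..d}"
    have "f s * g s - f t * g t = g s * (f s - f t) + f t * (g s - g t)" by (simp add: algebra_simps)
    also have "norm \<dots> \<le> norm (g s) * norm (f s - f t) + norm (f t) * norm (g s - g t)"
      by (metis norm_triangle_ineq norm_mult)
    also have "\<dots> \<le> max B1 B2 * norm (f s - f t) + max B1 B2 * norm (g s - g t)"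
      using B st by (intro add_mono mult_right_mono) (auto simp: le_max_iff_disj)
    finally show "norm (f s * g s - f t * g t) \<le> max B1 B2 * norm (f s - f t) + max B1 B2 * norm (g s - g t)" .
  qed (use B in auto)
qed

section \<open>Solutions on intervals without interaction centres\<close>

text \<open>
  Wronskians are undefined at the centres, where the derivatives jump, but they are constant
  near each point off that point. The value near \<open>t\<close> is a locally constant function of \<open>t\<close>.
\<close>
lemma eventually_locally_constant_imp_constant:
  fixes S :: "real set"
  assumes "open S" "connected S" and loc: "\<And>t. t \<in> S \<Longrightarrow> \<exists>C. \<forall>\<^sub>F s in at t. W s = C"
  shows "\<exists>C. \<forall>t\<in>S. \<forall>\<^sub>F s in at t. W s = C"
proof -
  define L where "L t = (SOME C. \<forall>\<^sub>F s in at t. W s = C)" for t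
  have L: "\<forall>\<^sub>F s in at t. W s = L t" if "t \<in> S" for t
    unfolding L_def using loc[OF that] by (rule someI_ex)
  have uniq: "C = L t" if t: "t \<in> S" and C: "\<forall>\<^sub>F s in at t. W s = C" for t C
  proof -
    have "\<forall>\<^sub>F s in at t. C = L t" using C L[OF t] by eventually_elim simp
    then show ?thesis by simp
  qed
  have "L constant_on S"
  proof (rule locally_constant_imp_constant[OF \<open>connected S\<close>])
    fix t assume t: "t \<in> S"
    obtain T where T: "open T" "t \<in> T" "\<forall>s\<in>T. s \<noteq> t \<longrightarrow> W s = L t"
      using L[OF t] unfolding eventually_at_topological by blast
    have "L s = L t" if s: "s \<in> T \<inter> S" for s
    proof (cases "s = t")
      case False
      have "\<forall>\<^sub>F s' in at s. s' \<in> T - {t}"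
        using s False T(1) by (intro eventually_at_in_open') auto
      then have "\<forall>\<^sub>F s' in at s. W s' = L t" by eventually_elim (use T(3) in auto)
      then show ?thesis using uniq[of s "L t"] s by simp
    qed simp
    then show "\<exists>T. openin (top_of_set S) T \<and> t \<in> T \<and> (\<forall>x\<in>T. L x = L t)"
      using openin_open_Int[OF T(1), of S] T(2) t by (intro exI[of _ "S \<inter> T"]) blast
  qed
  then obtain C where "\<forall>t\<in>S. L t = C" unfolding constant_on_def by blast
  then show ?thesis using L by (intro exI[of _ C]) auto
qed

definition wronskian :: "(real \<Rightarrow> complex) \<Rightarrow> (real \<Rightarrow> complex) \<Rightarrow> real \<Rightarrow> complex" where
  "wronskian f g t = f t * D1 g t - D1 f t * g t"

definition cauchy_size :: "(real \<Rightarrow> complex) \<Rightarrow> real \<Rightarrow> real" where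
  "cauchy_size f t = norm (f t) + norm (D1 f t)"

locale point_interactions =
  fixes a b :: ereal and V :: "real \<Rightarrow> real" and I :: "int set" and x :: "int \<Rightarrow> real"
  assumes V: "L1_loc (einterval a b) V"
    and inj: "inj_on x I" and centres: "x ` I \<subseteq> einterval a b"
    and discrete: "\<And>t. t \<in> einterval a b \<Longrightarrow> \<not> t islimpt x ` I"
begin

abbreviation "J \<equiv> einterval a b"
abbreviation "M \<equiv> x ` I"
abbreviation "adm \<equiv> delta_admissible a b I x"
abbreviation "sol \<equiv> is_solution a b V I x"

text \<open>
  Indexing the interaction strengths by points, with strength \<open>0\<close> away from the centres, makes the jump
  condition uniform over \<open>(a,b)\<close>: \<open>f'(t+) - f'(t-)\<close> is the strength at \<open>t\<close> times \<open>f(t)\<close> for all \<open>t\<close>.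
\<close>
definition strength :: "(int \<Rightarrow> real) \<Rightarrow> real \<Rightarrow> real" where
  "strength \<omega> t = (if t \<in> M then \<omega> (inv_into I x t) else 0)"

lemma strength_at [simp]: "n \<in> I \<Longrightarrow> strength \<omega> (x n) = \<omega> n"
  using inj by (auto simp: strength_def)

lemma open_J: "open J" by simp

lemma sol_adm: "sol \<omega> z f \<Longrightarrow> adm \<omega> f"
  by (simp add: is_solution_def)

lemma isolating_interval:
  assumes t: "t \<in> J"
  obtains \<delta> where "\<delta> > 0" "{t-\<delta>..t+\<delta>} \<subseteq> J" "{t-\<delta>..t+\<delta>} \<inter> M \<subseteq> {t}"
proof -
  obtain e1 where e1: "e1 > 0" "cball t e1 \<subseteq> J" using open_J t open_contains_cball by blast
  obtain e2 where e2: "e2 > 0" "\<And>m. m \<in> M \<Longrightarrow> m \<noteq> t \<Longrightarrow> e2 \<le> dist m t"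
    using discrete[OF t] unfolding islimpt_approachable by force
  show thesis
  proof
    show "min e1 (e2/2) > 0" using e1 e2 by simp
    show "{t - min e1 (e2/2)..t + min e1 (e2/2)} \<subseteq> J"
      by (rule subset_trans[OF _ e1(2)]) (auto simp: cball_eq_atLeastAtMost)
    show "{t - min e1 (e2/2)..t + min e1 (e2/2)} \<inter> M \<subseteq> {t}"
    proof
      fix m assume m: "m \<in> {t - min e1 (e2/2)..t + min e1 (e2/2)} \<inter> M"
      then have "m - t \<le> e2/2" "t - m \<le> e2/2" by auto
      then have "dist m t \<le> e2/2" unfolding dist_real_def by linarith
      then show "m \<in> {t}" using e2(1) e2(2)[of m] m by force
    qed
  qed
qed

lemma adm_on_free_interval:
  assumes "adm \<omega> f" "{c..d} \<subseteq> J - M"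
  shows "abs_cont_on {c..d} f" "abs_cont_on {c..d} (D1 f)"
    "\<And>t. t \<in> {c..d} \<Longrightarrow> (f has_vector_derivative D1 f t) (at t)"
  using assms unfolding delta_admissible_def loc_abs_cont_on_def
  by (auto simp: vector_derivative_works[symmetric])

text \<open>
  The expression \<open>tau V f t\<close> contains \<open>f''(t)\<close> as a total operator, whose value says nothing where \<open>f'\<close> fails to be
  differentiable. The differential equation thus becomes a statement about a derivative only because \<open>f'\<close>
  is differentiable almost everywhere.
\<close>
lemma sol_second_derivative:
  assumes f: "sol \<omega> z f" and cd: "{c..d} \<subseteq> J - M"
  obtains N where "negligible N"
    "\<And>t. t \<in> {c..d} - N \<Longrightarrow> (D1 f has_vector_derivative (of_real (V t) - z) * f t) (at t)"
proof -
  have "AE t in lebesgue. t \<in> J \<longrightarrow> tau V f t - z * f t = 0"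
    using f by (simp add: is_solution_def ae_eq_on_def AE_restrict_space_iff)
  then obtain N0 where N0: "negligible N0" "{t. \<not> (t \<in> J \<longrightarrow> tau V f t - z * f t = 0)} \<subseteq> N0"
    unfolding eventually_ae_filter_negligible by blast
  let ?N1 = "{t \<in> {c<..<d}. \<not> D1 f differentiable (at t)}"
  have N1: "negligible ?N1"
    by (rule AC_differentiable_ae) (rule adm_on_free_interval[OF sol_adm[OF f] cd])
  show thesis
  proof
    show "negligible (N0 \<union> ?N1 \<union> {c, d})" using N0 N1 by auto
    fix t assume t: "t \<in> {c..d} - (N0 \<union> ?N1 \<union> {c, d})"
    then have "D1 f differentiable (at t)" "t \<in> J" "t \<notin> N0" using cd by auto
    then have "(D1 f has_vector_derivative D1 (D1 f) t) (at t)" "tau V f t - z * f t = 0"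
      using N0(2) by (auto simp: vector_derivative_works)
    then show "(D1 f has_vector_derivative (of_real (V t) - z) * f t) (at t)"
      by (simp add: tau_def algebra_simps)
  qed
qed

lemma wronskian_eq_on_free_interval:
  assumes f: "sol \<omega> z f" and g: "sol \<omega>' z g" and cd: "{c..d} \<subseteq> J - M" "c \<le> d"
  shows "wronskian f g c = wronskian f g d"
proof -
  note F = adm_on_free_interval[OF sol_adm[OF f] cd(1)]
  note G = adm_on_free_interval[OF sol_adm[OF g] cd(1)]
  obtain N1 where N1: "negligible N1"
    "\<And>t. t \<in> {c..d} - N1 \<Longrightarrow> (D1 f has_vector_derivative (of_real (V t) - z) * f t) (at t)"
    using sol_second_derivative[OF f cd(1)] by metis
  obtain N2 where N2: "negligible N2"
    "\<And>t. t \<in> {c..d} - N2 \<Longrightarrow> (D1 g has_vector_derivative (of_real (V t) - z) * g t) (at t)"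
    using sol_second_derivative[OF g cd(1)] by metis
  have ac: "abs_cont_on {c..d} (wronskian f g)"
    unfolding wronskian_def by (intro abs_cont_on_diff abs_cont_on_mult F G)
  have N: "negligible (N1 \<union> N2)" using N1 N2 by auto
  have der: "(wronskian f g has_vector_derivative 0) (at t within {c..d})" if t: "t \<in> {c..d} - (N1 \<union> N2)" for t
  proof -
    let ?q = "of_real (V t) - z"
    have "((\<lambda>t. f t * D1 g t - D1 f t * g t) has_vector_derivative
       (f t * (?q * g t) + D1 f t * D1 g t) - (D1 f t * D1 g t + (?q * f t) * g t)) (at t)"
      using t by (intro has_vector_derivative_diff has_vector_derivative_mult F G N1 N2) auto
    then have "(wronskian f g has_vector_derivative 0) (at t)"
      by (simp add: wronskian_def[abs_def] algebra_simps)
    then show ?thesis by (rule has_vector_derivative_at_within)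
  qed
  have "((\<lambda>_. 0) has_integral (wronskian f g d - wronskian f g c)) {c..d}"
    by (rule AC_fundamental_theorem_of_calculus[OF ac cd(2) N der])
  then show ?thesis by simp
qed

lemma coefficient_integrable:
  assumes "{c..d} \<subseteq> J"
  shows "(\<lambda>t. norm (complex_of_real (V t) - z)) integrable_on {c..d}"
proof -
  have "V absolutely_integrable_on {c..d}" using V assms unfolding L1_loc_def by simp
  then have "(complex_of_real \<circ> V) absolutely_integrable_on {c..d}"
    by (rule absolutely_integrable_linear) (rule bounded_linear_of_real)
  then have "(\<lambda>t. complex_of_real (V t) - z) absolutely_integrable_on {c..d}"
    by (intro set_integral_diff absolutely_integrable_on_const) (auto simp: o_def)
  then show ?thesis unfolding absolutely_integrable_on_def by blast
qed

text \<open>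
  Take the maximum of the size of the Cauchy data between \<open>s\<close> and \<open>t\<close>, attained at \<open>m\<close> say. Integrating
  \<open>f'\<close> and \<open>f'' = (V - z) f\<close> from \<open>s\<close> to \<open>m\<close> shows that the Cauchy data change by at most half of this
  maximum, so the maximum is at most twice the size at \<open>s\<close>. As the constant \<open>2\<close> is uniform on the open
  interval, the comparison passes to limits at the end points, where a centre may lie.
\<close>
lemma sol_harnack:
  assumes f: "sol \<omega> z f" and J: "{\<alpha>..\<beta>} \<subseteq> J" "{\<alpha><..<\<beta>} \<subseteq> J - M"
    and small: "integral {\<alpha>..\<beta>} (\<lambda>t. 1 + norm (complex_of_real (V t) - z)) \<le> 1/2"
    and s: "s \<in> {\<alpha><..<\<beta>}" and t: "t \<in> {\<alpha><..<\<beta>}"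
  shows "cauchy_size f t \<le> 2 * cauchy_size f s"
proof -
  let ?q = "\<lambda>t. norm (complex_of_real (V t) - z)"
  have free: "{u..v} \<subseteq> J - M" if "u \<in> {\<alpha><..<\<beta>}" "v \<in> {\<alpha><..<\<beta>}" for u v
  proof -
    have "{u..v} \<subseteq> {\<alpha><..<\<beta>}" using that by auto
    then show ?thesis using J(2) by blast
  qed
  let ?c = "min s t" and ?d = "max s t"
  have cd: "{?c..?d} \<subseteq> J - M" using s t by (intro free) (auto simp: min_def max_def)
  have "continuous_on {?c..?d} (cauchy_size f)"
    unfolding cauchy_size_def[abs_def]
    by (intro continuous_intros abs_cont_on_imp_continuous_on adm_on_free_interval[OF sol_adm[OF f] cd])
  moreover have "{?c..?d} \<noteq> {}" by auto
  ultimately obtain m where m: "m \<in> {?c..?d}" "\<forall>r\<in>{?c..?d}. cauchy_size f r \<le> cauchy_size f m"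
    using continuous_attains_sup[OF compact_Icc] by blast
  let ?S = "cauchy_size f m"
  let ?u = "min s m" and ?v = "max s m"
  have uv_sub: "{?u..?v} \<subseteq> {?c..?d}" using m(1) by auto
  have uv: "{?u..?v} \<subseteq> J - M" "{?u..?v} \<subseteq> {\<alpha>..\<beta>}" "?u \<le> ?v"
    using uv_sub cd s t m(1) by (blast, auto)
  note F = adm_on_free_interval[OF sol_adm[OF f] uv(1)]
  obtain N where N: "negligible N"
    "\<And>t. t \<in> {?u..?v} - N \<Longrightarrow> (D1 f has_vector_derivative (of_real (V t) - z) * f t) (at t)"
    using sol_second_derivative[OF f uv(1)] by metis
  have i1: "(D1 f has_integral (f ?v - f ?u)) {?u..?v}"
    by (rule AC_fundamental_theorem_of_calculus[OF F(1) uv(3) negligible_empty])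
       (rule has_vector_derivative_at_within, rule F(3), blast)
  have i2: "((\<lambda>t. (of_real (V t) - z) * f t) has_integral (D1 f ?v - D1 f ?u)) {?u..?v}"
    by (rule AC_fundamental_theorem_of_calculus[OF F(2) uv(3) N(1)])
       (rule has_vector_derivative_at_within[OF N(2)])
  have le: "norm (f r) \<le> ?S" "norm (D1 f r) \<le> ?S" if "r \<in> {?u..?v}" for r
  proof -
    have "cauchy_size f r \<le> ?S" using m(2) that uv_sub by blast
    then show "norm (f r) \<le> ?S" "norm (D1 f r) \<le> ?S"
      unfolding cauchy_size_def[of f r] using norm_ge_zero[of "f r"] norm_ge_zero[of "D1 f r"] by linarith+
  qed
  have qi: "?q integrable_on {?u..?v}" by (rule coefficient_integrable) (use uv in blast)
  have q1i: "(\<lambda>t. 1 + ?q t) integrable_on {?u..?v}" "(\<lambda>t. 1 + ?q t) integrable_on {\<alpha>..\<beta>}"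
    using qi coefficient_integrable[OF J(1)] by (auto intro!: integrable_add integrable_const_ivl)
  have qSi: "(\<lambda>t. ?S * ?q t) integrable_on {?u..?v}" using integrable_cmul[OF qi, of ?S] by simp
  have "norm (f ?v - f ?u) \<le> integral {?u..?v} (\<lambda>_. ?S)"
    using integral_norm_bound_integral[of "D1 f" "{?u..?v}" "\<lambda>_. ?S"] i1 le(2)
    by (simp add: has_integral_iff integrable_const_ivl)
  moreover have "norm (D1 f ?v - D1 f ?u) \<le> integral {?u..?v} (\<lambda>t. ?S * ?q t)"
  proof -
    have "norm ((of_real (V r) - z) * f r) \<le> ?S * ?q r" if "r \<in> {?u..?v}" for r
      using le(1)[OF that] by (simp add: norm_mult mult.commute mult_right_mono)
    then show ?thesis
      using integral_norm_bound_integral[of "\<lambda>t. (of_real (V t) - z) * f t" "{?u..?v}" "\<lambda>t. ?S * ?q t"] i2 qSi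
      by (simp add: has_integral_iff)
  qed
  ultimately have "norm (f ?v - f ?u) + norm (D1 f ?v - D1 f ?u) \<le> integral {?u..?v} (\<lambda>_. ?S) + integral {?u..?v} (\<lambda>t. ?S * ?q t)"
    by linarith
  also have "\<dots> = integral {?u..?v} (\<lambda>t. ?S + ?S * ?q t)"
    by (intro integral_add[symmetric] integrable_const_ivl qSi)
  also have "\<dots> = integral {?u..?v} (\<lambda>t. ?S * (1 + ?q t))" by (simp add: distrib_left)
  also have "\<dots> = ?S * integral {?u..?v} (\<lambda>t. 1 + ?q t)" by simp
  also have "\<dots> \<le> ?S * (1/2)"
  proof (rule mult_left_mono)
    have "integral {?u..?v} (\<lambda>t. 1 + ?q t) \<le> integral {\<alpha>..\<beta>} (\<lambda>t. 1 + ?q t)"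
      by (rule integral_subset_le[OF uv(2) q1i]) auto
    then show "integral {?u..?v} (\<lambda>t. 1 + ?q t) \<le> 1/2" using small by linarith
  qed (simp add: cauchy_size_def)
  finally have "norm (f m - f s) + norm (D1 f m - D1 f s) \<le> ?S / 2"
    by (cases "s \<le> m") (auto simp: min_def max_def norm_minus_commute)
  moreover have "?S \<le> cauchy_size f s + (norm (f m - f s) + norm (D1 f m - D1 f s))"
    unfolding cauchy_size_def using norm_triangle_sub[of "f m" "f s"] norm_triangle_sub[of "D1 f m" "D1 f s"] by linarith
  ultimately have "?S \<le> 2 * cauchy_size f s" by linarith
  moreover have "cauchy_size f t \<le> ?S" by (rule bspec[OF m(2)]) auto
  ultimately show ?thesis by linarith
qed

lemma small_isolating_interval:
  assumes t: "t \<in> J"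
  obtains \<delta> where "\<delta> > 0" "{t-\<delta>..t+\<delta>} \<subseteq> J" "{t-\<delta>..t+\<delta>} \<inter> M \<subseteq> {t}"
    "integral {t-\<delta>..t+\<delta>} (\<lambda>t. 1 + norm (complex_of_real (V t) - z)) \<le> 1/2"
proof -
  let ?q = "\<lambda>t. 1 + norm (complex_of_real (V t) - z)"
  obtain \<delta>0 where \<delta>0: "\<delta>0 > 0" "{t-\<delta>0..t+\<delta>0} \<subseteq> J" "{t-\<delta>0..t+\<delta>0} \<inter> M \<subseteq> {t}"
    using isolating_interval[OF t] by metis
  have qi: "?q integrable_on {t-\<delta>0..t+\<delta>0}"
    using coefficient_integrable[OF \<delta>0(2)] by (auto intro!: integrable_add integrable_const_ivl)
  define Q where "Q y = integral {t-\<delta>0..y} ?q" for y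
  have "continuous_on {t-\<delta>0..t+\<delta>0} Q"
    unfolding Q_def by (rule indefinite_integral_continuous_1[OF qi])
  then obtain r where r: "r > 0" "\<And>s. s \<in> {t-\<delta>0..t+\<delta>0} \<Longrightarrow> dist s t < r \<Longrightarrow> dist (Q s) (Q t) < 1/4"
    using \<delta>0(1) unfolding continuous_on_iff
    by (metis atLeastAtMost_iff diff_le_eq le_add_same_cancel1 less_imp_le zero_less_divide_1_iff zero_less_numeral)
  define \<delta> where "\<delta> = min \<delta>0 (r/2)"
  have \<delta>: "\<delta> > 0" "\<delta> \<le> \<delta>0" "\<delta> < r" using \<delta>0 r by (auto simp: \<delta>_def)
  show thesis
  proof
    have sub: "{t-\<delta>..t+\<delta>} \<subseteq> {t-\<delta>0..t+\<delta>0}" using \<delta> by auto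
    then show "{t-\<delta>..t+\<delta>} \<subseteq> J" "{t-\<delta>..t+\<delta>} \<inter> M \<subseteq> {t}" using \<delta>0 by blast+
    have "?q integrable_on {t-\<delta>0..t+\<delta>}" using qi by (rule integrable_subinterval_real) (use \<delta> in auto)
    then have "Q (t+\<delta>) = Q (t-\<delta>) + integral {t-\<delta>..t+\<delta>} ?q"
      unfolding Q_def using \<delta> by (intro Henstock_Kurzweil_Integration.integral_combine[symmetric]) auto
    moreover have "dist (Q (t+\<delta>)) (Q t) < 1/4" "dist (Q (t-\<delta>)) (Q t) < 1/4"
      using \<delta> r(2)[of "t + \<delta>"] r(2)[of "t - \<delta>"] by (auto simp: dist_real_def)
    ultimately show "integral {t-\<delta>..t+\<delta>} ?q \<le> 1/2" unfolding dist_real_def by linarith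
  qed (use \<delta> in simp)
qed

end

section \<open>Crossing the interaction centres\<close>

lemma connected_einterval: "connected (einterval a b)"
proof (rule is_interval_connected)
  show "is_interval (einterval a b)"
    unfolding is_interval_1
  proof (intro ballI allI impI)
    fix u v t assume "u \<in> einterval a b" "v \<in> einterval a b" "u \<le> t \<and> t \<le> v"
    then have "a < ereal u" "ereal u \<le> ereal t" "ereal t \<le> ereal v" "ereal v < b"
      by (auto simp: einterval_iff)
    then show "t \<in> einterval a b" unfolding einterval_iff using less_le_trans le_less_trans by blast
  qed
qed

context point_interactions
begin

lemma isCont_D1:
  assumes f: "adm \<omega> f" and t: "t \<in> J - M"
  shows "isCont (D1 f) t"
proof -
  have tJ: "t \<in> J" using t by blast
  obtain \<delta> where \<delta>: "\<delta> > 0" "{t-\<delta>..t+\<delta>} \<subseteq> J" "{t-\<delta>..t+\<delta>} \<inter> M \<subseteq> {t}"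
    by (rule isolating_interval[OF tJ])
  then have "{t-\<delta>..t+\<delta>} \<subseteq> J - M" using t by blast
  then have "continuous_on {t-\<delta>..t+\<delta>} (D1 f)"
    by (rule abs_cont_on_imp_continuous_on[OF adm_on_free_interval(2)[OF f]])
  then show ?thesis using \<delta>(1) by (intro continuous_on_interior[of _ "D1 f"]) auto
qed

lemma adm_limits:
  assumes f: "adm \<omega> f" and t: "t \<in> J"
  obtains l r where "isCont f t" "(D1 f \<longlongrightarrow> l) (at_left t)" "(D1 f \<longlongrightarrow> r) (at_right t)"
    "r - l = of_real (strength \<omega> t) * f t"
proof (cases "t \<in> M")
  case True
  then obtain n where n: "n \<in> I" "t = x n" by blast
  then show thesis using f that unfolding delta_admissible_def by fastforce
next
  case False
  have "isCont f t" using f t False unfolding delta_admissible_def by (auto intro: differentiable_imp_continuous_within)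
  moreover have "(D1 f \<longlongrightarrow> D1 f t) (at t)" using isCont_D1[OF f] t False by (auto simp: isCont_def)
  ultimately show thesis using False by (intro that[of "D1 f t" "D1 f t"]) (auto simp: filterlim_at_split strength_def)
qed

lemma adm_isCont: "adm \<omega> f \<Longrightarrow> t \<in> J \<Longrightarrow> isCont f t"
  by (rule adm_limits)

lemma tendsto_one_sided:
  fixes f :: "real \<Rightarrow> complex"
  assumes "isCont f t"
  shows "(f \<longlongrightarrow> f t) (at_left t)" "(f \<longlongrightarrow> f t) (at_right t)"
  using assms by (auto simp: continuous_at filterlim_at_split)

text \<open>
  The Wronskian is constant on a free interval to the left of \<open>t\<close>, so it equals its own limit at \<open>t\<close>.
\<close>
lemma wronskian_near_left:
  assumes f: "sol \<omega> z f" and g: "sol \<omega>' z g" and t: "t \<in> J"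
    and lf: "(D1 f \<longlongrightarrow> lf) (at_left t)" and lg: "(D1 g \<longlongrightarrow> lg) (at_left t)"
  shows "\<forall>\<^sub>F s in at_left t. wronskian f g s = f t * lg - lf * g t"
proof -
  obtain \<delta> where \<delta>: "\<delta> > 0" "{t-\<delta>..t+\<delta>} \<subseteq> J" "{t-\<delta>..t+\<delta>} \<inter> M \<subseteq> {t}"
    by (rule isolating_interval[OF t])
  have eq: "wronskian f g s = wronskian f g (t - \<delta>/2)" if s: "s \<in> {t-\<delta><..<t}" for s
  proof -
    have free: "{u..v} \<subseteq> J - M" if "t - \<delta> < u" "v < t" for u v
    proof -
      have "{u..v} \<subseteq> {t-\<delta>..t+\<delta>}" "t \<notin> {u..v}" using that \<delta>(1) by auto
      then show ?thesis using \<delta>(2,3) by blast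
    qed
    show ?thesis
    proof (cases "s \<le> t - \<delta>/2")
      case True
      then show ?thesis using s \<delta>(1) by (intro wronskian_eq_on_free_interval[OF f g free]) auto
    next
      case False
      then show ?thesis using s \<delta>(1) by (intro wronskian_eq_on_free_interval[OF f g free, symmetric]) auto
    qed
  qed
  have ev: "\<forall>\<^sub>F s in at_left t. wronskian f g s = wronskian f g (t - \<delta>/2)"
    by (rule eventually_at_leftI[of "t - \<delta>"], erule eq) (use \<delta>(1) in simp)
  have "(wronskian f g \<longlongrightarrow> f t * lg - lf * g t) (at_left t)"
    unfolding wronskian_def[abs_def]
    by (intro tendsto_intros lf lg tendsto_one_sided adm_isCont[OF sol_adm[OF f] t] adm_isCont[OF sol_adm[OF g] t])
  moreover have "(wronskian f g \<longlongrightarrow> wronskian f g (t - \<delta>/2)) (at_left t)"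
    by (rule tendsto_eventually[OF ev])
  ultimately have "wronskian f g (t - \<delta>/2) = f t * lg - lf * g t"
    by (intro tendsto_unique[OF trivial_limit_at_left_real])
  then show ?thesis using ev by simp
qed

lemma wronskian_near_right:
  assumes f: "sol \<omega> z f" and g: "sol \<omega>' z g" and t: "t \<in> J"
    and rf: "(D1 f \<longlongrightarrow> rf) (at_right t)" and rg: "(D1 g \<longlongrightarrow> rg) (at_right t)"
  shows "\<forall>\<^sub>F s in at_right t. wronskian f g s = f t * rg - rf * g t"
proof -
  obtain \<delta> where \<delta>: "\<delta> > 0" "{t-\<delta>..t+\<delta>} \<subseteq> J" "{t-\<delta>..t+\<delta>} \<inter> M \<subseteq> {t}"
    by (rule isolating_interval[OF t])
  have eq: "wronskian f g s = wronskian f g (t + \<delta>/2)" if s: "s \<in> {t<..<t+\<delta>}" for s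
  proof -
    have free: "{u..v} \<subseteq> J - M" if "t < u" "v < t + \<delta>" for u v
    proof -
      have "{u..v} \<subseteq> {t-\<delta>..t+\<delta>}" "t \<notin> {u..v}" using that \<delta>(1) by auto
      then show ?thesis using \<delta>(2,3) by blast
    qed
    show ?thesis
    proof (cases "s \<le> t + \<delta>/2")
      case True
      then show ?thesis using s \<delta>(1) by (intro wronskian_eq_on_free_interval[OF f g free]) auto
    next
      case False
      then show ?thesis using s \<delta>(1) by (intro wronskian_eq_on_free_interval[OF f g free, symmetric]) auto
    qed
  qed
  have ev: "\<forall>\<^sub>F s in at_right t. wronskian f g s = wronskian f g (t + \<delta>/2)"
    by (rule eventually_at_rightI[of _ "t + \<delta>"], erule eq) (use \<delta>(1) in simp)
  have "(wronskian f g \<longlongrightarrow> f t * rg - rf * g t) (at_right t)"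
    unfolding wronskian_def[abs_def]
    by (intro tendsto_intros rf rg tendsto_one_sided adm_isCont[OF sol_adm[OF f] t] adm_isCont[OF sol_adm[OF g] t])
  moreover have "(wronskian f g \<longlongrightarrow> wronskian f g (t + \<delta>/2)) (at_right t)"
    by (rule tendsto_eventually[OF ev])
  ultimately have "wronskian f g (t + \<delta>/2) = f t * rg - rf * g t"
    by (intro tendsto_unique[OF trivial_limit_at_right_real])
  then show ?thesis using ev by simp
qed

text \<open>
  For equal strengths the jump \<open>(\<omega>'(t) - \<omega>(t)) f(t) g(t)\<close> of the Wronskian is zero at every point \<open>t\<close> of \<open>S\<close>.
\<close>
lemma wronskian_constant:
  assumes f: "sol \<omega> z f" and g: "sol \<omega>' z g" and S: "open S" "connected S" "S \<subseteq> J"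
    and same: "\<And>t. t \<in> S \<Longrightarrow> strength \<omega> t = strength \<omega>' t"
  obtains C where "\<forall>t\<in>S. \<forall>\<^sub>F s in at t. wronskian f g s = C" "\<forall>t\<in>S - M. wronskian f g t = C"
proof -
  have "\<exists>C. \<forall>\<^sub>F s in at t. wronskian f g s = C" if t: "t \<in> S" for t
  proof -
    have tJ: "t \<in> J" using t S by blast
    obtain lf rf where F: "isCont f t" "(D1 f \<longlongrightarrow> lf) (at_left t)" "(D1 f \<longlongrightarrow> rf) (at_right t)"
      "rf - lf = of_real (strength \<omega> t) * f t" by (rule adm_limits[OF sol_adm[OF f] tJ])
    obtain lg rg where G: "isCont g t" "(D1 g \<longlongrightarrow> lg) (at_left t)" "(D1 g \<longlongrightarrow> rg) (at_right t)"
      "rg - lg = of_real (strength \<omega>' t) * g t" by (rule adm_limits[OF sol_adm[OF g] tJ])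
    have "rf = lf + of_real (strength \<omega> t) * f t" "rg = lg + of_real (strength \<omega> t) * g t"
      using F(4) G(4) same[OF t] by (simp_all add: algebra_simps)
    then have "f t * rg - rf * g t = f t * lg - lf * g t" by (simp add: algebra_simps)
    then have "\<forall>\<^sub>F s in at t. wronskian f g s = f t * lg - lf * g t"
      using wronskian_near_left[OF f g tJ F(2) G(2)] wronskian_near_right[OF f g tJ F(3) G(3)]
      by (simp add: eventually_at_split)
    then show ?thesis ..
  qed
  then obtain C where C: "\<forall>t\<in>S. \<forall>\<^sub>F s in at t. wronskian f g s = C"
    using eventually_locally_constant_imp_constant[OF S(1,2), of "wronskian f g"] by blast
  have "wronskian f g t = C" if t: "t \<in> S - M" for t
  proof -
    have tJ: "t \<in> J - M" "t \<in> J" "t \<in> S" using t S by auto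
    have "\<forall>\<^sub>F s in at_left t. wronskian f g s = f t * D1 g t - D1 f t * g t"
      using isCont_D1[OF sol_adm[OF f] tJ(1)] isCont_D1[OF sol_adm[OF g] tJ(1)]
      by (intro wronskian_near_left[OF f g tJ(2)] tendsto_one_sided)
    moreover have "\<forall>\<^sub>F s in at_left t. wronskian f g s = C"
      using C tJ(3) by (auto simp: eventually_at_split)
    ultimately have "\<forall>\<^sub>F s in at_left t. wronskian f g t = C"
      by eventually_elim (simp add: wronskian_def)
    then show ?thesis by simp
  qed
  then show thesis using C by (intro that[of C]) auto
qed

text \<open>
  By the Harnack comparison, the Cauchy data on either side of a point vanish identically near the point or nowhere
  near it, according to their one-sided limits. The jump condition shows that the limits from
  the left and from the right vanish simultaneously, so whether the Cauchy data vanish is locally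
  constant across the centres too.
\<close>
lemma sol_unique_continuation:
  assumes g: "sol \<omega> z g" and t: "t \<in> J" "g t = 0" "(D1 g \<longlongrightarrow> 0) (at_left t)"
  shows "\<forall>s\<in>J. g s = 0"
proof -
  have side: "(\<forall>\<^sub>F s in F. (cauchy_size g s = 0) = (g t = 0 \<and> l = 0))"
    if t: "t \<in> J" and lim: "(D1 g \<longlongrightarrow> l) F" "(g \<longlongrightarrow> g t) F" "F \<noteq> bot"
      and ev: "\<forall>\<^sub>F s in F. s \<in> {\<alpha><..<\<beta>}" and J: "{\<alpha>..\<beta>} \<subseteq> J" "{\<alpha><..<\<beta>} \<subseteq> J - M"
      and small: "integral {\<alpha>..\<beta>} (\<lambda>t. 1 + norm (complex_of_real (V t) - z)) \<le> 1/2" for t l F \<alpha> \<beta>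
  proof -
    have lim': "(cauchy_size g \<longlongrightarrow> norm (g t) + norm l) F"
      unfolding cauchy_size_def[abs_def] by (intro tendsto_intros lim)
    note harnack = sol_harnack[OF g J small]
    have nn: "cauchy_size g s \<ge> 0" for s by (simp add: cauchy_size_def)
    have "(cauchy_size g s = 0) = (g t = 0 \<and> l = 0)" if s: "s \<in> {\<alpha><..<\<beta>}" for s
    proof
      assume 0: "cauchy_size g s = 0"
      have "\<forall>\<^sub>F r in F. cauchy_size g r = 0"
        using ev by eventually_elim (use harnack[OF s] 0 nn in \<open>simp add: order.antisym\<close>)
      then have "(cauchy_size g \<longlongrightarrow> 0) F" by (rule tendsto_eventually)
      then have "norm (g t) + norm l = 0" using lim' lim(3) by (intro tendsto_unique) auto
      then show "g t = 0 \<and> l = 0" by (simp add: add_nonneg_eq_0_iff)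
    next
      assume "g t = 0 \<and> l = 0"
      then have "((\<lambda>r. 2 * cauchy_size g r) \<longlongrightarrow> 2 * 0) F" using lim' by (intro tendsto_intros) simp
      moreover have "\<forall>\<^sub>F r in F. cauchy_size g s \<le> 2 * cauchy_size g r"
        using ev by eventually_elim (rule harnack[OF _ s])
      ultimately have "cauchy_size g s \<le> 2 * 0" using lim(3) by (rule tendsto_lowerbound)
      then show "cauchy_size g s = 0" using nn[of s] by simp
    qed
    then show ?thesis using ev by (auto elim: eventually_mono)
  qed
  have near: "(\<forall>\<^sub>F s in at t. (cauchy_size g s = 0) = (g t = 0 \<and> l = 0))"
    if t: "t \<in> J" and l: "(D1 g \<longlongrightarrow> l) (at_left t)" for t l
  proof -
    obtain l' r where G: "isCont g t" "(D1 g \<longlongrightarrow> l') (at_left t)" "(D1 g \<longlongrightarrow> r) (at_right t)"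
      "r - l' = of_real (strength \<omega> t) * g t" by (rule adm_limits[OF sol_adm[OF g] t])
    have "l' = l" using G(2) l by (intro tendsto_unique[OF trivial_limit_at_left_real])
    obtain \<delta> where \<delta>: "\<delta> > 0" "{t-\<delta>..t+\<delta>} \<subseteq> J" "{t-\<delta>..t+\<delta>} \<inter> M \<subseteq> {t}"
      "integral {t-\<delta>..t+\<delta>} (\<lambda>t. 1 + norm (complex_of_real (V t) - z)) \<le> 1/2"
      by (rule small_isolating_interval[OF t])
    have small: "integral {u..v} (\<lambda>t. 1 + norm (complex_of_real (V t) - z)) \<le> 1/2"
      if sub: "{u..v} \<subseteq> {t-\<delta>..t+\<delta>}" for u v
    proof -
      have "(\<lambda>t. 1 + norm (complex_of_real (V t) - z)) integrable_on {u..v}"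
        "(\<lambda>t. 1 + norm (complex_of_real (V t) - z)) integrable_on {t-\<delta>..t+\<delta>}"
        using coefficient_integrable[OF subset_trans[OF sub \<delta>(2)]] coefficient_integrable[OF \<delta>(2)]
        by (auto intro!: integrable_add integrable_const_ivl)
      then have "integral {u..v} (\<lambda>t. 1 + norm (complex_of_real (V t) - z)) \<le>
          integral {t-\<delta>..t+\<delta>} (\<lambda>t. 1 + norm (complex_of_real (V t) - z))"
        by (rule integral_subset_le[OF sub]) auto
      then show ?thesis using \<delta>(4) by linarith
    qed
    have L: "\<forall>\<^sub>F s in at_left t. (cauchy_size g s = 0) = (g t = 0 \<and> l = 0)"
    proof (rule side[OF t l tendsto_one_sided(1)[OF G(1)], where \<alpha> = "t - \<delta>" and \<beta> = t])
      show "\<forall>\<^sub>F s in at_left t. s \<in> {t - \<delta><..<t}" by (rule eventually_at_leftI[of "t - \<delta>"]) (use \<delta>(1) in auto)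
      have "{t-\<delta>..t} \<subseteq> {t-\<delta>..t+\<delta>}" using \<delta>(1) by auto
      then show "{t-\<delta>..t} \<subseteq> J" "integral {t-\<delta>..t} (\<lambda>t. 1 + norm (complex_of_real (V t) - z)) \<le> 1/2"
        using \<delta>(2) small by blast+
      have "{t-\<delta><..<t} \<subseteq> {t-\<delta>..t+\<delta>}" "t \<notin> {t-\<delta><..<t}" using \<delta>(1) by auto
      then show "{t-\<delta><..<t} \<subseteq> J - M" using \<delta>(2,3) by blast
    qed simp
    have "\<forall>\<^sub>F s in at_right t. (cauchy_size g s = 0) = (g t = 0 \<and> r = 0)"
    proof (rule side[OF t G(3) tendsto_one_sided(2)[OF G(1)], where \<alpha> = t and \<beta> = "t + \<delta>"])
      show "\<forall>\<^sub>F s in at_right t. s \<in> {t<..<t + \<delta>}" by (rule eventually_at_rightI[of _ "t + \<delta>"]) (use \<delta>(1) in auto)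
      have "{t..t+\<delta>} \<subseteq> {t-\<delta>..t+\<delta>}" using \<delta>(1) by auto
      then show "{t..t+\<delta>} \<subseteq> J" "integral {t..t+\<delta>} (\<lambda>t. 1 + norm (complex_of_real (V t) - z)) \<le> 1/2"
        using \<delta>(2) small by blast+
      have "{t<..<t+\<delta>} \<subseteq> {t-\<delta>..t+\<delta>}" "t \<notin> {t<..<t+\<delta>}" using \<delta>(1) by auto
      then show "{t<..<t+\<delta>} \<subseteq> J - M" using \<delta>(2,3) by blast
    qed simp
    moreover have "(g t = 0 \<and> r = 0) = (g t = 0 \<and> l = 0)" using G(4) \<open>l' = l\<close> by auto
    ultimately have "\<forall>\<^sub>F s in at_right t. (cauchy_size g s = 0) = (g t = 0 \<and> l = 0)" by simp
    with L show ?thesis by (simp add: eventually_at_split)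
  qed
  have "\<exists>C. \<forall>\<^sub>F s in at t. (cauchy_size g s = 0) = C" if "t \<in> J" for t
    using near[OF that] adm_limits[OF sol_adm[OF g] that] by metis
  then obtain C where C: "\<forall>t\<in>J. \<forall>\<^sub>F s in at t. (cauchy_size g s = 0) = C"
    using eventually_locally_constant_imp_constant[OF open_J connected_einterval, of "\<lambda>s. cauchy_size g s = 0"] by blast
  have "\<forall>\<^sub>F s in at t. cauchy_size g s = 0" using near[OF t(1,3)] t(2) by simp
  then have "\<forall>\<^sub>F s in at t. C" using bspec[OF C t(1)] by eventually_elim simp
  then have C': C by simp
  show ?thesis
  proof
    fix s assume s: "s \<in> J"
    have "\<forall>\<^sub>F r in at s. g r = 0"
      using bspec[OF C s] C' by (auto elim!: eventually_mono simp: cauchy_size_def add_nonneg_eq_0_iff)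
    then have "(g \<longlongrightarrow> 0) (at s)" by (rule tendsto_eventually)
    moreover have "(g \<longlongrightarrow> g s) (at s)" using adm_isCont[OF sol_adm[OF g] s] by (simp add: isCont_def)
    ultimately show "g s = 0" by (intro tendsto_unique[OF trivial_limit_at]) auto
  qed
qed

end

section \<open>Wronskians of eigenfunctions vanish\<close>
lemma L2_subset:
  assumes "L2 S f" "T \<subseteq> S" "S \<in> sets lebesgue" "T \<in> sets lebesgue"
  shows "L2 T f"
  unfolding L2_def
proof
  show "f \<in> borel_measurable (lebesgue_on T)"
    using assms(1,2) unfolding L2_def by (blast intro: measurable_restrict_mono)
  have "set_integrable lebesgue S (\<lambda>t. (norm (f t))\<^sup>2)"
    using assms(1,3) by (simp add: L2_def set_integrable_def integrable_restrict_space)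
  then have "set_integrable lebesgue T (\<lambda>t. (norm (f t))\<^sup>2)"
    by (rule set_integrable_subset) (use assms in auto)
  then show "integrable (lebesgue_on T) (\<lambda>t. (norm (f t))\<^sup>2)"
    using assms(4) by (simp add: set_integrable_def integrable_restrict_space)
qed

lemma L2_linear_combination:
  assumes u: "L2 S u" and v: "L2 S v" and f: "\<And>t. t \<in> S \<Longrightarrow> f t = \<alpha> * u t + \<beta> * v t"
  shows "L2 S f"
proof -
  have um: "u \<in> borel_measurable (lebesgue_on S)" and vm: "v \<in> borel_measurable (lebesgue_on S)"
    using u v by (auto simp: L2_def)
  then have "(\<lambda>t. \<alpha> * u t + \<beta> * v t) \<in> borel_measurable (lebesgue_on S)" by measurable
  moreover have "f \<in> borel_measurable (lebesgue_on S) \<longleftrightarrow> (\<lambda>t. \<alpha> * u t + \<beta> * v t) \<in> borel_measurable (lebesgue_on S)"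
    by (rule measurable_cong) (simp add: f)
  ultimately have fm: "f \<in> borel_measurable (lebesgue_on S)" by simp
  have "integrable (lebesgue_on S) (\<lambda>t. 2 * (norm \<alpha>)\<^sup>2 * (norm (u t))\<^sup>2 + 2 * (norm \<beta>)\<^sup>2 * (norm (v t))\<^sup>2)"
    using u v by (intro Bochner_Integration.integrable_add integrable_mult_right) (auto simp: L2_def)
  then have "integrable (lebesgue_on S) (\<lambda>t. (norm (f t))\<^sup>2)"
  proof (rule Bochner_Integration.integrable_bound)
    show "(\<lambda>t. (norm (f t))\<^sup>2) \<in> borel_measurable (lebesgue_on S)" using fm by measurable
    have "(norm (f t))\<^sup>2 \<le> 2 * (norm \<alpha>)\<^sup>2 * (norm (u t))\<^sup>2 + 2 * (norm \<beta>)\<^sup>2 * (norm (v t))\<^sup>2" if "t \<in> S" for t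
    proof -
      let ?x = "norm (\<alpha> * u t)" and ?y = "norm (\<beta> * v t)"
      have "norm (f t) \<le> ?x + ?y" unfolding f[OF that] by (rule norm_triangle_ineq)
      then have "(norm (f t))\<^sup>2 \<le> (?x + ?y)\<^sup>2" by (rule power_mono) simp
      also have "\<dots> \<le> 2 * ?x\<^sup>2 + 2 * ?y\<^sup>2"
        using zero_le_power2[of "?x - ?y"] by (simp add: power2_sum power2_diff)
      finally show ?thesis by (simp add: norm_mult power_mult_distrib)
    qed
    then show "AE t in lebesgue_on S. norm ((norm (f t))\<^sup>2) \<le> norm (2 * (norm \<alpha>)\<^sup>2 * (norm (u t))\<^sup>2 + 2 * (norm \<beta>)\<^sup>2 * (norm (v t))\<^sup>2)"
      by (intro AE_I2) (fastforce simp: abs_if)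
  qed
  with fm show ?thesis by (simp add: L2_def)
qed

text \<open>
  Both pairs of boundary values are orthogonal to the nonzero vector \<open>(cos \<theta>, sin \<theta>)\<close>, so their determinant is zero.
\<close>
lemma boundary_cond_determinant:
  assumes f: "boundary_cond F \<theta> f" and g: "boundary_cond F \<theta> g"
  shows "(wronskian f g \<longlongrightarrow> 0) F"
proof -
  obtain v v' where f': "(f \<longlongrightarrow> v) F" "(D1 f \<longlongrightarrow> v') F" "v * of_real (cos \<theta>) + v' * of_real (sin \<theta>) = 0"
    using f unfolding boundary_cond_def by blast
  obtain w w' where g': "(g \<longlongrightarrow> w) F" "(D1 g \<longlongrightarrow> w') F" "w * of_real (cos \<theta>) + w' * of_real (sin \<theta>) = 0"
    using g unfolding boundary_cond_def by blast
  let ?c = "complex_of_real (cos \<theta>)" and ?s = "complex_of_real (sin \<theta>)"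
  have "?c * (v * w' - v' * w) = w' * (v * ?c + v' * ?s) - v' * (w * ?c + w' * ?s)" by (simp add: algebra_simps)
  then have c: "?c * (v * w' - v' * w) = 0" using f'(3) g'(3) by simp
  have "?s * (v * w' - v' * w) = v * (w * ?c + w' * ?s) - w * (v * ?c + v' * ?s)" by (simp add: algebra_simps)
  then have s: "?s * (v * w' - v' * w) = 0" using f'(3) g'(3) by simp
  have "cos \<theta> \<noteq> 0 \<or> sin \<theta> \<noteq> 0" 
    by (metis sin_cos_squared_add power_zero_numeral add_0 zero_neq_one)
  then have "v * w' - v' * w = 0" using c s by auto
  moreover have "(wronskian f g \<longlongrightarrow> v * w' - v' * w) F"
    unfolding wronskian_def[abs_def] by (intro tendsto_intros f' g')
  ultimately show ?thesis by simp
qed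

context point_interactions
begin

lemma wronskian_zero_if_boundary_cond:
  assumes f: "sol \<omega> z f" and g: "sol \<omega>' z g" and S: "open S" "connected S" "S \<subseteq> J"
    and same: "\<And>t. t \<in> S \<Longrightarrow> strength \<omega> t = strength \<omega>' t"
    and bc: "boundary_cond F \<theta> f" "boundary_cond F \<theta> g" and F: "F \<noteq> bot" "\<forall>\<^sub>F s in F. s \<in> S - M"
    and t: "t \<in> S - M"
  shows "wronskian f g t = 0"
proof -
  obtain C where C: "\<forall>t\<in>S. \<forall>\<^sub>F s in at t. wronskian f g s = C" "\<forall>t\<in>S - M. wronskian f g t = C"
    by (rule wronskian_constant[OF f g S same])
  have "(wronskian f g \<longlongrightarrow> C) F"
    by (rule tendsto_eventually) (use F(2) C(2) in \<open>auto elim!: eventually_mono\<close>)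
  then have "C = 0" using boundary_cond_determinant[OF bc] F(1) by (intro tendsto_unique)
  then show ?thesis using bspec[OF C(2) t] by simp
qed

text \<open>
  The identity \<open>h W(f,g) = W(h,g) f + W(f,h) g\<close> holds pointwise for any three functions. If \<open>W(f,g) \<noteq> 0\<close>, it
  exhibits \<open>h\<close> as a linear combination of \<open>f\<close> and \<open>g\<close> on \<open>S\<close>, so \<open>h\<close> would be square integrable too.
\<close>
lemma wronskian_zero_if_limit_point:
  assumes f: "sol \<omega> z f" and g: "sol \<omega>' z g" and S: "open S" "connected S" "S \<subseteq> J"
    and same: "\<And>t. t \<in> S \<Longrightarrow> strength \<omega> t = strength \<omega>' t"
    and L2: "L2 S f" "L2 S g" and h: "sol \<omega> z h" "\<not> L2 S h"
    and t: "t \<in> S - M"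
  shows "wronskian f g t = 0"
proof (rule ccontr)
  assume nz: "wronskian f g t \<noteq> 0"
  obtain C where C: "\<forall>t\<in>S. \<forall>\<^sub>F s in at t. wronskian f g s = C" "\<forall>t\<in>S - M. wronskian f g t = C"
    by (rule wronskian_constant[OF f g S same])
  obtain Cf where Cf: "\<forall>t\<in>S. \<forall>\<^sub>F s in at t. wronskian h g s = Cf" "\<forall>t\<in>S - M. wronskian h g t = Cf"
    by (rule wronskian_constant[OF h(1) g S same])
  obtain Cg where Cg: "\<forall>t\<in>S. \<forall>\<^sub>F s in at t. wronskian f h s = Cg" "\<forall>t\<in>S - M. wronskian f h t = Cg"
    by (rule wronskian_constant[OF f h(1) S refl])
  have "C \<noteq> 0" using nz bspec[OF C(2) t] by simp
  have "h s = (Cf / C) * f s + (Cg / C) * g s" if s: "s \<in> S" for s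
  proof -
    have sJ: "s \<in> J" using s S by blast
    \<comment> \<open>The relation holds near \<open>s\<close> off \<open>s\<close>; continuity extends it to \<open>s\<close>, which may be a centre.\<close>
    have ev: "\<forall>\<^sub>F r in at s. h r * C = Cf * f r + Cg * g r"
      using bspec[OF C(1) s] bspec[OF Cf(1) s] bspec[OF Cg(1) s]
    proof eventually_elim
      case (elim r)
      have "h r * wronskian f g r = wronskian h g r * f r + wronskian f h r * g r"
        by (simp add: wronskian_def algebra_simps)
      then show ?case using elim by simp
    qed
    have lims: "((\<lambda>r. h r * C) \<longlongrightarrow> h s * C) (at s)" "((\<lambda>r. Cf * f r + Cg * g r) \<longlongrightarrow> Cf * f s + Cg * g s) (at s)"
      using adm_isCont[OF sol_adm[OF f] sJ] adm_isCont[OF sol_adm[OF g] sJ] adm_isCont[OF sol_adm[OF h(1)] sJ]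
      unfolding isCont_def by (auto intro!: tendsto_intros)
    have "h s * C = Cf * f s + Cg * g s"
      by (rule tendsto_unique[OF trivial_limit_at lims(1)]) (use lims(2) in \<open>simp only: tendsto_cong[OF ev]\<close>)
    then show ?thesis using \<open>C \<noteq> 0\<close> by (simp add: field_simps)
  qed
  then have "L2 S h" by (rule L2_linear_combination[OF L2])
  then show False using h(2) by simp
qed

lemma eigenfunction_sol:
  assumes "is_eigenfunction J (H_op a b V I x \<theta> \<gamma> \<omega>) z f"
  shows "sol \<omega> z f" "L2 J f"
    "regular_left a b V I x \<Longrightarrow> boundary_cond (at_right (real_of_ereal a)) \<theta> f"
    "regular_right a b V I x \<Longrightarrow> boundary_cond (at_left (real_of_ereal b)) \<gamma> f"
    "\<not> (\<forall>t\<in>J. f t = 0)"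
proof -
  have "AE t in lebesgue_on J. tau V f t = z * f t"
    using assms by (simp add: is_eigenfunction_def H_op_def T_op_def ae_eq_on_def)
  then have "AE t in lebesgue_on J. tau V f t - z * f t = 0" by eventually_elim simp
  then show "sol \<omega> z f"
    using assms by (simp add: is_eigenfunction_def H_op_def T_op_def is_solution_def ae_eq_on_def)
  show "L2 J f"
    "regular_left a b V I x \<Longrightarrow> boundary_cond (at_right (real_of_ereal a)) \<theta> f"
    "regular_right a b V I x \<Longrightarrow> boundary_cond (at_left (real_of_ereal b)) \<gamma> f"
    using assms by (simp_all add: is_eigenfunction_def H_op_def T_op_def)
  show "\<not> (\<forall>t\<in>J. f t = 0)"
  proof
    assume "\<forall>t\<in>J. f t = 0"
    then have "ae_eq_on J f (\<lambda>_. 0)" unfolding ae_eq_on_def by (intro AE_I2) simp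
    then show False using assms by (simp add: is_eigenfunction_def)
  qed
qed

lemma eventually_free:
  assumes "t \<in> J"
  shows "\<forall>\<^sub>F s in at_left t. s \<in> J - M" "\<forall>\<^sub>F s in at_right t. s \<in> J - M"
proof -
  obtain \<delta> where \<delta>: "\<delta> > 0" "{t-\<delta>..t+\<delta>} \<subseteq> J" "{t-\<delta>..t+\<delta>} \<inter> M \<subseteq> {t}"
    by (rule isolating_interval[OF assms])
  have free: "s \<in> J - M" if "s \<in> {t-\<delta>..t+\<delta>}" "s \<noteq> t" for s using that \<delta>(2,3) by blast
  show "\<forall>\<^sub>F s in at_left t. s \<in> J - M"
    by (rule eventually_at_leftI[of "t - \<delta>"], rule free) (use \<delta>(1) in auto)
  show "\<forall>\<^sub>F s in at_right t. s \<in> J - M"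
    by (rule eventually_at_rightI[of _ "t + \<delta>"], rule free) (use \<delta>(1) in auto)
qed

lemma eventually_notin_centres:
  assumes "\<not> t islimpt M"
  shows "\<forall>\<^sub>F s in at_left t. s \<notin> M" "\<forall>\<^sub>F s in at_right t. s \<notin> M"
  using assms by (auto simp: islimpt_iff_eventually eventually_at_split)

lemma wronskian_zero_left:
  assumes f: "is_eigenfunction J (H_op a b V I x \<theta> \<gamma> \<omega>) z f"
    and g: "is_eigenfunction J (H_op a b V I x \<theta> \<gamma> \<omega>') z g"
    and left: "regular_left a b V I x \<or> lpc_left a b V I x \<omega>"
    and c: "c \<in> J" and same: "\<And>t. t \<in> J \<Longrightarrow> t < c \<Longrightarrow> strength \<omega> t = strength \<omega>' t"
  shows "\<forall>\<^sub>F s in at_left c. wronskian f g s = 0"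
proof -
  note F = eigenfunction_sol[OF f] and G = eigenfunction_sol[OF g]
  let ?S = "einterval a (ereal c)"
  have "?S \<subseteq> J"
    using c less_trans unfolding subset_iff einterval_iff by blast
  then have S: "open ?S" "connected ?S" "?S \<subseteq> J" by (simp_all add: connected_einterval)
  have same': "strength \<omega> t = strength \<omega>' t" if "t \<in> ?S" for t
    using same[of t] that S(3) by (auto simp: einterval_iff)
  have "wronskian f g t = 0" if t: "t \<in> ?S - M" for t
  proof (cases "regular_left a b V I x")
    case True
    then obtain a' where a': "a = ereal a'" by (auto simp: regular_left_def)
    have "a' < c" using c a' by (simp add: einterval_iff)
    then have "\<forall>\<^sub>F s in at_right a'. s \<in> {a'<..<c}"
      by (intro eventually_at_rightI[of _ c]) auto
    moreover have "\<forall>\<^sub>F s in at_right a'. s \<notin> M"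
      using True a' by (intro eventually_notin_centres) (simp add: regular_left_def)
    ultimately have "\<forall>\<^sub>F s in at_right a'. s \<in> ?S - M"
      by eventually_elim (simp add: a' einterval_iff)
    then show ?thesis
      using F(3)[OF True] G(3)[OF True] a'
      by (intro wronskian_zero_if_boundary_cond[OF F(1) G(1) S same' _ _ _ _ t, of "at_right a'" \<theta>]) auto
  next
    case False
    then obtain h where h: "sol \<omega> z h" "\<not> L2 ?S h" using left c unfolding lpc_left_def by blast
    have "L2 ?S f" "L2 ?S g" using F(2) G(2) S(3) by (auto intro: L2_subset)
    then show ?thesis using wronskian_zero_if_limit_point[OF F(1) G(1) S same' _ _ h t] by blast
  qed
  moreover have below: "\<forall>\<^sub>F s in at_left c. s < c" by (rule eventually_at_leftI[of "c - 1"]) auto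
  moreover have "\<forall>\<^sub>F s in at_left c. s \<in> ?S - M"
    using eventually_free(1)[OF c] below
    by eventually_elim (simp add: einterval_iff)
  ultimately show ?thesis by (auto elim: eventually_mono)
qed

lemma wronskian_zero_right:
  assumes f: "is_eigenfunction J (H_op a b V I x \<theta> \<gamma> \<omega>) z f"
    and g: "is_eigenfunction J (H_op a b V I x \<theta> \<gamma> \<omega>') z g"
    and right: "regular_right a b V I x \<or> lpc_right a b V I x \<omega>"
    and c: "c \<in> J" and same: "\<And>t. t \<in> J \<Longrightarrow> c < t \<Longrightarrow> strength \<omega> t = strength \<omega>' t"
  shows "\<forall>\<^sub>F s in at_right c. wronskian f g s = 0"
proof -
  note F = eigenfunction_sol[OF f] and G = eigenfunction_sol[OF g]
  let ?S = "einterval (ereal c) b"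
  have "?S \<subseteq> J"
    using c less_trans unfolding subset_iff einterval_iff by blast
  then have S: "open ?S" "connected ?S" "?S \<subseteq> J" by (simp_all add: connected_einterval)
  have same': "strength \<omega> t = strength \<omega>' t" if "t \<in> ?S" for t
    using same[of t] that S(3) by (auto simp: einterval_iff)
  have "wronskian f g t = 0" if t: "t \<in> ?S - M" for t
  proof (cases "regular_right a b V I x")
    case True
    then obtain b' where b': "b = ereal b'" by (auto simp: regular_right_def)
    have "c < b'" using c b' by (simp add: einterval_iff)
    then have "\<forall>\<^sub>F s in at_left b'. s \<in> {c<..<b'}"
      by (intro eventually_at_leftI[of c]) auto
    moreover have "\<forall>\<^sub>F s in at_left b'. s \<notin> M"
      using True b' by (intro eventually_notin_centres) (simp add: regular_right_def)
    ultimately have "\<forall>\<^sub>F s in at_left b'. s \<in> ?S - M"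
      by eventually_elim (simp add: b' einterval_iff)
    then show ?thesis
      using F(4)[OF True] G(4)[OF True] b'
      by (intro wronskian_zero_if_boundary_cond[OF F(1) G(1) S same' _ _ _ _ t, of "at_left b'" \<gamma>]) auto
  next
    case False
    then obtain h where h: "sol \<omega> z h" "\<not> L2 ?S h" using right c unfolding lpc_right_def by blast
    have "L2 ?S f" "L2 ?S g" using F(2) G(2) S(3) by (auto intro: L2_subset)
    then show ?thesis using wronskian_zero_if_limit_point[OF F(1) G(1) S same' _ _ h t] by blast
  qed
  moreover have "\<forall>\<^sub>F s in at_right c. s \<in> ?S - M"
    using eventually_free(2)[OF c] eventually_at_right_less[of c]
    by eventually_elim (simp add: einterval_iff)
  ultimately show ?thesis by (auto elim: eventually_mono)
qed

text \<open>
  The Wronskian of \<open>f\<close> and \<open>g\<close> vanishes on both sides of \<open>x n\<close>, so \<open>(g(x\<^sub>n), g'(x\<^sub>n\<plusminus>))\<close> is proportional to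
  \<open>(f(x\<^sub>n), f'(x\<^sub>n\<plusminus>))\<close>. If \<open>g\<close> is nonzero at \<open>x n\<close>, then \<open>f\<close> and \<open>g\<close> have the same logarithmic derivatives on
  either side, and the jump of the logarithmic derivative is the strength. If \<open>g\<close> is zero at \<open>x n\<close>, so are
  its one-sided derivatives, and \<open>g\<close> vanishes by unique continuation.
\<close>
lemma eigenvalue_fixes_strength:
  assumes f: "is_eigenfunction J (H_op a b V I x \<theta> \<gamma> \<omega>) z f"
    and g: "is_eigenfunction J (H_op a b V I x \<theta> \<gamma> \<omega>') z g"
    and left: "regular_left a b V I x \<or> lpc_left a b V I x \<omega>"
    and right: "regular_right a b V I x \<or> lpc_right a b V I x \<omega>"
    and n: "n \<in> I" and fn: "f (x n) \<noteq> 0"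
    and same: "\<And>m. m \<in> I \<Longrightarrow> m \<noteq> n \<Longrightarrow> \<omega>' m = \<omega> m"
  shows "\<omega>' n = \<omega> n"
proof -
  note F = eigenfunction_sol[OF f] and G = eigenfunction_sol[OF g]
  have c: "x n \<in> J" using n centres by blast
  have same': "strength \<omega> t = strength \<omega>' t" if "t \<noteq> x n" for t
  proof (cases "t \<in> M")
    case True
    then obtain m where "m \<in> I" "t = x m" by blast
    moreover from this have "m \<noteq> n" using that by blast
    ultimately show ?thesis using same[of m] by simp
  qed (simp add: strength_def)
  obtain lf rf where f': "(D1 f \<longlongrightarrow> lf) (at_left (x n))" "(D1 f \<longlongrightarrow> rf) (at_right (x n))"
    "rf - lf = of_real (strength \<omega> (x n)) * f (x n)" by (rule adm_limits[OF sol_adm[OF F(1)] c])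
  obtain lg rg where g': "(D1 g \<longlongrightarrow> lg) (at_left (x n))" "(D1 g \<longlongrightarrow> rg) (at_right (x n))"
    "rg - lg = of_real (strength \<omega>' (x n)) * g (x n)" by (rule adm_limits[OF sol_adm[OF G(1)] c])
  have WL: "\<forall>\<^sub>F s in at_left (x n). wronskian f g s = 0"
    by (rule wronskian_zero_left[OF f g left c]) (simp add: same')
  have "\<forall>\<^sub>F s in at_left (x n). f (x n) * lg - lf * g (x n) = 0"
    using wronskian_near_left[OF F(1) G(1) c f'(1) g'(1)] WL
    by eventually_elim simp
  then have L: "f (x n) * lg = lf * g (x n)" by simp
  have WR: "\<forall>\<^sub>F s in at_right (x n). wronskian f g s = 0"
    by (rule wronskian_zero_right[OF f g right c]) (simp add: same')
  have "\<forall>\<^sub>F s in at_right (x n). f (x n) * rg - rf * g (x n) = 0"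
    using wronskian_near_right[OF F(1) G(1) c f'(2) g'(2)] WR
    by eventually_elim simp
  then have R: "f (x n) * rg = rf * g (x n)" by simp
  have "g (x n) \<noteq> 0"
  proof
    assume 0: "g (x n) = 0"
    then have "lg = 0" using L fn by simp
    then have "\<forall>t\<in>J. g t = 0" using sol_unique_continuation[OF G(1) c 0] g'(1) by simp
    then show False using G(5) by simp
  qed
  moreover have "of_real (\<omega>' n) * (f (x n) * g (x n)) = of_real (\<omega> n) * (f (x n) * g (x n))"
  proof -
    have "f (x n) * (rg - lg) = (rf - lf) * g (x n)" using L R by (simp add: algebra_simps)
    then show ?thesis using f'(3) g'(3) n by (simp add: algebra_simps)
  qed
  ultimately show ?thesis using fn by simp
qed

lemma eigenfunction_change_strength:
  assumes f: "is_eigenfunction J (H_op a b V I x \<theta> \<gamma> \<omega>) z f" and 0: "\<And>n. n \<in> I \<Longrightarrow> f (x n) = 0"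
  shows "is_eigenfunction J (H_op a b V I x \<theta> \<gamma> \<omega>') z f"
proof -
  have "adm \<omega> f \<longleftrightarrow> adm \<omega>' f" using 0 by (simp add: delta_admissible_def)
  then show ?thesis using f by (simp add: is_eigenfunction_def H_op_def T_op_def)
qed

end

section \<open>Measurable sets with null fibres\<close>

text \<open>
  The direction \<open>n\<close> of the null fibre may depend on \<open>\<omega>\<close> in a non-measurable way. The sets \<open>C n\<close> of all points of \<open>B\<close>
  whose fibre in direction \<open>n\<close> is null are nevertheless measurable, because they are defined from \<open>B\<close> alone.
  A fibre of \<open>C n\<close> in direction \<open>n\<close> is either empty or a null fibre of \<open>B\<close>.
\<close>
lemma emeasure_PiM_eq_0_if_null_fibres:
  assumes "countable I" and prob: "\<And>i. i \<in> I \<Longrightarrow> prob_space (p i)" and B: "B \<in> sets (PiM I p)"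
    and fibre: "\<And>\<omega>. \<omega> \<in> B \<Longrightarrow> \<exists>n\<in>I. emeasure (p n) {y \<in> space (p n). \<omega> (n := y) \<in> B} = 0"
  shows "emeasure (PiM I p) B = 0"
proof -
  define C where "C n = {\<omega> \<in> B. emeasure (p n) {y \<in> space (p n). \<omega> (n := y) \<in> B} = 0}" for n
  have null: "C n \<in> null_sets (PiM I p)" if n: "n \<in> I" for n
  proof -
    interpret pn: prob_space "p n" by (rule prob[OF n])
    interpret rest: prob_space "PiM (I - {n}) p" by (rule prob_space_PiM) (use prob in auto)
    interpret pair_sigma_finite "p n" "PiM (I - {n}) p" ..
    have I: "insert n (I - {n}) = I" using n by blast
    have sub: "B \<subseteq> space (PiM I p)" using B by (rule sets.sets_into_space)
    have upd: "(\<lambda>(\<omega>, y). \<omega> (n := y)) \<in> PiM I p \<Otimes>\<^sub>M p n \<rightarrow>\<^sub>M PiM I p"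
      unfolding case_prod_unfold by (rule measurable_fun_upd[of I I n]) (use n in \<open>auto simp: measurable_fst measurable_snd\<close>)
    let ?Q = "(\<lambda>(\<omega>, y). \<omega> (n := y)) -` B \<inter> space (PiM I p \<Otimes>\<^sub>M p n)"
    have Q: "?Q \<in> sets (PiM I p \<Otimes>\<^sub>M p n)" using upd B by (rule measurable_sets)
    have fib: "Pair \<omega> -` ?Q = {y \<in> space (p n). \<omega> (n := y) \<in> B}" if "\<omega> \<in> space (PiM I p)" for \<omega>
      using that by (auto simp: space_pair_measure)
    have "C n = B \<inter> {\<omega> \<in> space (PiM I p). emeasure (p n) (Pair \<omega> -` ?Q) = 0}"
      using sub fib by (auto simp: C_def)
    also have "\<dots> \<in> sets (PiM I p)"
      using B pn.measurable_emeasure_Pair[OF Q] by measurable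
    finally have Cs: "C n \<in> sets (PiM I p)" .
    let ?T = "\<lambda>(y, X). X(n := y)"
    have T: "?T \<in> p n \<Otimes>\<^sub>M PiM (I - {n}) p \<rightarrow>\<^sub>M PiM I p"
      unfolding case_prod_unfold
      by (rule measurable_fun_upd[of I "I - {n}" n]) (use n in \<open>auto simp: measurable_fst measurable_snd\<close>)
    have "PiM I p = distr (p n \<Otimes>\<^sub>M PiM (I - {n}) p) (PiM I p) ?T"
      using distr_pair_PiM_eq_PiM[of "I - {n}" p n] prob n unfolding I by simp
    then have "emeasure (PiM I p) (C n) = emeasure (distr (p n \<Otimes>\<^sub>M PiM (I - {n}) p) (PiM I p) ?T) (C n)"
      by (rule arg_cong)
    also have "\<dots> = emeasure (p n \<Otimes>\<^sub>M PiM (I - {n}) p) (?T -` C n \<inter> space (p n \<Otimes>\<^sub>M PiM (I - {n}) p))"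
      by (rule emeasure_distr[OF T Cs])
    also have "\<dots> = (\<integral>\<^sup>+X. emeasure (p n) ((\<lambda>y. (y, X)) -` (?T -` C n \<inter> space (p n \<Otimes>\<^sub>M PiM (I - {n}) p))) \<partial>PiM (I - {n}) p)"
      by (rule emeasure_pair_measure_alt2) (rule measurable_sets[OF T Cs])
    also have "\<dots> = (\<integral>\<^sup>+X. 0 \<partial>PiM (I - {n}) p)"
    proof (rule nn_integral_cong)
      fix X assume X: "X \<in> space (PiM (I - {n}) p)"
      have eq: "(\<lambda>y. (y, X)) -` (?T -` C n \<inter> space (p n \<Otimes>\<^sub>M PiM (I - {n}) p)) = {y \<in> space (p n). X(n := y) \<in> C n}"
        using X by (auto simp: space_pair_measure)
      show "emeasure (p n) ((\<lambda>y. (y, X)) -` (?T -` C n \<inter> space (p n \<Otimes>\<^sub>M PiM (I - {n}) p))) = 0"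
      proof (cases "emeasure (p n) {y \<in> space (p n). X(n := y) \<in> B} = 0")
        case True
        then have "{y \<in> space (p n). X(n := y) \<in> C n} = {y \<in> space (p n). X(n := y) \<in> B}"
          by (auto simp: C_def)
        then show ?thesis using True eq by simp
      next
        case False
        then have "{y \<in> space (p n). X(n := y) \<in> C n} = {}" by (auto simp: C_def)
        then show ?thesis unfolding eq by (simp only: emeasure_empty)
      qed
    qed
    finally show ?thesis using Cs by (simp add: null_sets_def)
  qed
  have "(\<Union>n\<in>I. C n) \<in> null_sets (PiM I p)" using \<open>countable I\<close> null by (rule null_sets_UN')
  moreover have "B \<subseteq> (\<Union>n\<in>I. C n)" using fibre by (auto simp: C_def)
  ultimately show ?thesis using B by (meson null_setsD1 null_sets_subset)
qed

section \<open>The random point interaction operators\<close>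
theorem corollary4p1:
  fixes I :: "int set" and p :: "int \<Rightarrow> real measure"
    and a b :: ereal and V :: "real \<Rightarrow> real" and x :: "int \<Rightarrow> real"
    and \<theta> \<gamma> E :: real
  assumes prob: "\<And>n. n \<in> I \<Longrightarrow> real_distribution (p n)"
    and continuous: "\<And>n r. n \<in> I \<Longrightarrow> emeasure (p n) {r} = 0"
    and "a < b"
    and V: "L1_loc (einterval a b) V"
    and points: "inj_on x I" "x ` I \<subseteq> einterval a b"
    and discrete: "\<And>t. t \<in> einterval a b \<Longrightarrow> \<not> t islimpt x ` I"
    and left: "\<And>\<omega>. \<omega> \<in> space (config_space I p) \<Longrightarrow>
                 regular_left a b V I x \<or> lpc_left a b V I x \<omega>"
    and right: "\<And>\<omega>. \<omega> \<in> space (config_space I p) \<Longrightarrow>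
                 regular_right a b V I x \<or> lpc_right a b V I x \<omega>"
    and angles: "\<theta> \<in> {0..<pi}" "\<gamma> \<in> {0..<pi}"
  defines "H \<equiv> H_op a b V I x \<theta> \<gamma> (\<lambda>n\<in>I. 0)"
    and "A \<equiv> A_set a b V I x \<theta> \<gamma> p E"
  shows "(complex_of_real E \<notin> sigma_p (einterval a b) H \<longrightarrow>
            (\<forall>B \<in> sets (config_space I p). B \<subseteq> A \<longrightarrow> emeasure (config_space I p) B = 0))
       \<and> (complex_of_real E \<in> sigma_p (einterval a b) H \<longrightarrow>
            (\<forall>u. is_eigenfunction (einterval a b) H (complex_of_real E) u \<longrightarrow>
               (A = space (config_space I p) \<longleftrightarrow> (\<forall>n\<in>I. u (x n) = 0))))"
proof -
  interpret point_interactions a b V I x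
    by unfold_locales (use V points discrete in auto)
  have space_p: "space (p n) = UNIV" if "n \<in> I" for n
    using sets_eq_imp_space_eq[of "p n" borel] prob[OF that]
    by (simp add: real_distribution_def real_distribution_axioms_def)
  have space: "space (config_space I p) = (\<Pi>\<^sub>E n\<in>I. UNIV)"
    unfolding config_space_def by (simp add: space_PiM space_p cong: PiE_cong)
  have A_iff: "\<omega> \<in> A \<longleftrightarrow> \<omega> \<in> space (config_space I p) \<and>
      (\<exists>u. is_eigenfunction J (H_op a b V I x \<theta> \<gamma> \<omega>) (of_real E) u)" for \<omega>
    by (simp add: A_def A_set_def sigma_p_def)
  have single: "y = \<omega> n"
    if \<omega>: "\<omega> \<in> space (config_space I p)" and u: "is_eigenfunction J (H_op a b V I x \<theta> \<gamma> \<omega>) (of_real E) u"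
      and n: "n \<in> I" "u (x n) \<noteq> 0" and A: "\<omega> (n := y) \<in> A" for \<omega> u n y
  proof -
    obtain v where "is_eigenfunction J (H_op a b V I x \<theta> \<gamma> (\<omega> (n := y))) (of_real E) v"
      using A A_iff by blast
    from eigenvalue_fixes_strength[OF u this left[OF \<omega>] right[OF \<omega>] n]
    show ?thesis by simp
  qed
  have part_a: "emeasure (config_space I p) B = 0"
    if E: "complex_of_real E \<notin> sigma_p J H" and B: "B \<in> sets (config_space I p)" "B \<subseteq> A" for B
  proof -
    \<comment> \<open>Replaces the completed \<open>\<sigma>\<close>-algebra by the product one: a subset of \<open>B\<close> of the same measure.\<close>
    let ?B = "main_part (PiM I p) B"
    have Bc: "B \<in> sets (completion (PiM I p))" using B(1) by (simp add: config_space_def)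
    have sub: "?B \<subseteq> A" using main_part_null_part_Un[OF Bc] B(2) by blast
    have "emeasure (PiM I p) ?B = 0"
    proof (rule emeasure_PiM_eq_0_if_null_fibres)
      show "countable I" by (rule countableI_type)
      show "prob_space (p i)" if "i \<in> I" for i using prob[OF that] by (simp add: real_distribution_def)
      show "?B \<in> sets (PiM I p)" by (rule main_part_sets[OF Bc])
      fix \<omega> assume "\<omega> \<in> ?B"
      then have "\<omega> \<in> A" using sub by blast
      then obtain u where \<omega>: "\<omega> \<in> space (config_space I p)"
        and u: "is_eigenfunction J (H_op a b V I x \<theta> \<gamma> \<omega>) (of_real E) u" using A_iff by blast
      have "\<exists>n\<in>I. u (x n) \<noteq> 0"
      proof (rule ccontr)
        assume "\<not> (\<exists>n\<in>I. u (x n) \<noteq> 0)"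
        then have "is_eigenfunction J H (of_real E) u"
          unfolding H_def by (intro eigenfunction_change_strength[OF u]) auto
        then show False using E by (auto simp: sigma_p_def)
      qed
      then obtain n where n: "n \<in> I" "u (x n) \<noteq> 0" by blast
      have "{y \<in> space (p n). \<omega> (n := y) \<in> ?B} \<subseteq> {\<omega> n}"
        using single[OF \<omega> u n] sub by blast
      moreover have "{\<omega> n} \<in> sets (p n)"
        using prob[OF n(1)] by (simp add: real_distribution_def real_distribution_axioms_def)
      ultimately have "emeasure (p n) {y \<in> space (p n). \<omega> (n := y) \<in> ?B} \<le> emeasure (p n) {\<omega> n}"
        by (rule emeasure_mono)
      then show "\<exists>n\<in>I. emeasure (p n) {y \<in> space (p n). \<omega> (n := y) \<in> ?B} = 0"
        using continuous[OF n(1)] n(1) by auto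
    qed
    then show ?thesis by (simp add: config_space_def emeasure_completion[OF Bc])
  qed
  have part_b: "A = space (config_space I p) \<longleftrightarrow> (\<forall>n\<in>I. u (x n) = 0)"
    if u: "is_eigenfunction J H (complex_of_real E) u" for u
  proof
    assume full: "A = space (config_space I p)"
    show "\<forall>n\<in>I. u (x n) = 0"
    proof (intro ballI, rule ccontr)
      fix n assume n: "n \<in> I" "u (x n) \<noteq> 0"
      let ?o = "\<lambda>n\<in>I. 0 :: real"
      have "?o(n := 1) \<in> space (config_space I p)" unfolding space using n(1) by (auto simp: PiE_def extensional_def)
      then have "?o(n := 1) \<in> A" using full by simp
      moreover have "?o \<in> space (config_space I p)" unfolding space by simp
      ultimately have "1 = ?o n" using single[of ?o u n 1] u n unfolding H_def by blast
      then show False using n(1) by simp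
    qed
  next
    assume "\<forall>n\<in>I. u (x n) = 0"
    then have "is_eigenfunction J (H_op a b V I x \<theta> \<gamma> \<omega>) (of_real E) u" for \<omega>
      by (intro eigenfunction_change_strength[OF u[unfolded H_def]]) auto
    then show "A = space (config_space I p)" using A_iff by blast
  qed
  show ?thesis using part_a part_b by blast
qed

end
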